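(* Let $r\ge 4$ be even, let $q$ be an odd prime power, let $\mathcal L$ be an $m$-cover of $\mathcal Q(r,q)$ and let $\bar{\mathcal L}$ be the set of points of $\mathcal Q(r,q^2)$ lying on the extended lines of $\mathcal L$. Then $\bar{\mathcal L}$ is an $(m(q^2-q)+q+1)$-tight set of $\mathcal Q(r,q^2)$ if and only if $\mathcal L$ is an $(r-2)$-dual cover of parabolic type $II$.
   Context: $\theta_{n,q}=q^n+\dots+q+1$ for $n\ge0$, $\theta_{-1,q}=0$; $\theta_{n,q^2}$ is the same expression with $q^2$ in place of $q$. $\mathcal Q(r,q)$ is the parabolic quadric (polar space) of $\Sigma=\mathrm{PG}(r,q)$, $q$ odd, $r\ge4$ even, given by a nondegenerate quadratic form $Q$ on $\mathbb F_q^{r+1}$, with orthogonal polarity $\perp$. Lines of $\mathcal Q(r,q)$ are the lines of $\Sigma$ contained in the quadric. An $m$-cover of lines of $\mathcal Q(r,q)$ ($m>0$) is a set $\mathcal L$ of lines of $\mathcal Q(r,q)$ such that every point of $\mathcal Q(r,q)$ lies on exactly $m$ lines of $\mathcal L$. An $m$-cover $\mathcal L$ of $\mathcal Q(r,q)$ is $(r-2)$-dual of parabolic type $II$ if, for every line $\ell$ of $\Sigma$, the number of lines of $\mathcal L$ contained in $\ell^\perp$ equals $\frac{m\theta_{r-5,q}}{q+1}+q^{r-4}$ if $\ell\in\mathcal L$, and equals $\frac{m\theta_{r-5,q}}{q+1}$ if $\ell\notin\mathcal L$ and $|\ell\cap\mathcal Q(r,q)|\in\{0,q+1\}$. $\Sigma$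 is embedded in $\mathrm{PG}(r,q^2)$ by extension of scalars; the extended line of a line $\ell$ of $\Sigma$ is the line of $\mathrm{PG}(r,q^2)$ containing the $q+1$ points of $\ell$. $\mathcal Q(r,q^2)$ is the parabolic quadric of $\mathrm{PG}(r,q^2)$ given by the extension of $Q$ to $\mathbb F_{q^2}^{r+1}$; its orthogonal polarity is also denoted $\perp$. A subset $\mathcal X$ of points of $\mathcal Q(r,q^2)$ is $i$-tight if for every point $P$ of $\mathcal Q(r,q^2)$, $|P^{\perp}\cap\mathcal X|$ equals $i\,\theta_{\frac{r-4}{2},q^2}+q^{r-2}$ if $P\in\mathcal X$ and $i\,\theta_{\frac{r-4}{2},q^2}$ if $P\notin\mathcal X$. *)

theory Defs
  imports "HOL-Analysis.Analysis"
begin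

text \<open>Gaussian numbers \<open>q^n + \<dots> + q + 1\<close>; the index is an integer because \<open>n = -1\<close>
  occurs, where the empty sum gives \<open>0\<close>.\<close>

definition theta :: "int \<Rightarrow> nat \<Rightarrow> nat" where
  "theta n q = (\<Sum>j<nat (n + 1). q ^ j)"

text \<open>Points and lines of the projective space of \<open>F^'n\<close>, whose projective dimension is
  \<open>CARD('n) - 1\<close>. They are represented as vector subspaces, so incidence is inclusion.\<close>

definition proj_points :: "('f::field ^ 'n) set set" where
  "proj_points = {P. vec.subspace P \<and> vec.dim P = 1}"

definition proj_lines :: "('f::field ^ 'n) set set" where
  "proj_lines = {l. vec.subspace l \<and> vec.dim l = 2}"

definition polar_form :: "('f::field ^ 'n \<Rightarrow> 'f) \<Rightarrow> 'f ^ 'n \<Rightarrow> 'f ^ 'n \<Rightarrow> 'f" where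
  "polar_form Q x y = Q (x + y) - Q x - Q y"

definition quadratic_form :: "('f::field ^ 'n \<Rightarrow> 'f) \<Rightarrow> bool" where
  "quadratic_form Q \<longleftrightarrow>
     (\<forall>c x. Q (c *s x) = c\<^sup>2 * Q x) \<and>
     (\<forall>x y z. polar_form Q (x + y) z = polar_form Q x z + polar_form Q y z) \<and>
     (\<forall>c x z. polar_form Q (c *s x) z = c * polar_form Q x z)"

text \<open>Nondegeneracy in the odd characteristic sense: the polar form has trivial radical.\<close>

definition nondegenerate :: "('f::field ^ 'n \<Rightarrow> 'f) \<Rightarrow> bool" where
  "nondegenerate Q \<longleftrightarrow> (\<forall>x. (\<forall>y. polar_form Q x y = 0) \<longrightarrow> x = 0)"

definition perp :: "('f::field ^ 'n \<Rightarrow> 'f) \<Rightarrow> ('f ^ 'n) set \<Rightarrow> ('f ^ 'n) set" where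
  "perp Q S = {y. \<forall>x\<in>S. polar_form Q x y = 0}"

definition quadric_points :: "('f::field ^ 'n \<Rightarrow> 'f) \<Rightarrow> ('f ^ 'n) set set" where
  "quadric_points Q = {P \<in> proj_points. \<forall>x\<in>P. Q x = 0}"

definition quadric_lines :: "('f::field ^ 'n \<Rightarrow> 'f) \<Rightarrow> ('f ^ 'n) set set" where
  "quadric_lines Q = {l \<in> proj_lines. \<forall>P\<in>proj_points. P \<subseteq> l \<longrightarrow> P \<in> quadric_points Q}"

definition m_cover ::
  "('f::field ^ 'n \<Rightarrow> 'f) \<Rightarrow> nat \<Rightarrow> ('f ^ 'n) set set \<Rightarrow> bool" where
  "m_cover Q m L \<longleftrightarrow> m > 0 \<and> L \<subseteq> quadric_lines Q \<and>
     (\<forall>P\<in>quadric_points Q. card {l \<in> L. P \<subseteq> l} = m)"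

text \<open>The parameters \<open>r\<close> and \<open>q\<close> below are meant to be the projective dimension and the order
  of the field of the (small) geometry. Lines that meet the quadric in one or two points are not
  constrained.\<close>

definition dual_parabolic_II ::
  "nat \<Rightarrow> nat \<Rightarrow> ('f::field ^ 'n \<Rightarrow> 'f) \<Rightarrow> nat \<Rightarrow> ('f ^ 'n) set set \<Rightarrow> bool" where
  "dual_parabolic_II r q Q m L \<longleftrightarrow>
     (\<forall>l\<in>proj_lines.
        (l \<in> L \<longrightarrow>
           real (card {k \<in> L. k \<subseteq> perp Q l}) =
             real m * real (theta (int r - 5) q) / (real q + 1) + real q ^ (r - 4)) \<and>
        (l \<notin> L \<and> card {P \<in> quadric_points Q. P \<subseteq> l} \<in> {0, q + 1} \<longrightarrow>
           real (card {k \<in> L. k \<subseteq> perp Q l}) =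
             real m * real (theta (int r - 5) q) / (real q + 1)))"

text \<open>Here \<open>Q\<close> is a form over the field with \<open>q\<^sup>2\<close> elements.\<close>

definition tight_set ::
  "nat \<Rightarrow> nat \<Rightarrow> ('f::field ^ 'n \<Rightarrow> 'f) \<Rightarrow> nat \<Rightarrow> ('f ^ 'n) set set \<Rightarrow> bool" where
  "tight_set r q Q i X \<longleftrightarrow> X \<subseteq> quadric_points Q \<and>
     (\<forall>P\<in>quadric_points Q.
        card {R \<in> X. R \<subseteq> perp Q P} =
          (if P \<in> X then i * theta ((int r - 4) div 2) (q\<^sup>2) + q ^ (r - 2)
           else i * theta ((int r - 4) div 2) (q\<^sup>2)))"

definition field_embedding :: "('a::field \<Rightarrow> 'b::field) \<Rightarrow> bool" where
  "field_embedding h \<longleftrightarrow> h 1 = 1 \<and>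
     (\<forall>x y. h (x + y) = h x + h y) \<and> (\<forall>x y. h (x * y) = h x * h y)"

definition ext_vec :: "('a::field \<Rightarrow> 'b::field) \<Rightarrow> 'a ^ 'n \<Rightarrow> 'b ^ 'n" where
  "ext_vec h x = (\<chi> i. h (x $ i))"

definition ext_line :: "('a::field \<Rightarrow> 'b::field) \<Rightarrow> ('a ^ 'n) set \<Rightarrow> ('b ^ 'n) set" where
  "ext_line h l = vec.span (ext_vec h ` l)"

text \<open>Extension of a quadratic form along \<open>h\<close>, for odd characteristic: the coefficients are
  read off from \<open>Q x = polar_form Q x x / 2\<close>. The lemmas below show that it is the unique quadratic
  form that agrees with \<open>Q\<close> on the image of \<open>h\<close>.\<close>

definition ext_form ::
  "('a::field \<Rightarrow> 'b::field) \<Rightarrow> ('a ^ 'n \<Rightarrow> 'a) \<Rightarrow> 'b ^ 'n \<Rightarrow> 'b" where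
  "ext_form h Q x =
     (\<Sum>i\<in>UNIV. \<Sum>j\<in>UNIV. h (polar_form Q (axis i 1) (axis j 1)) * x $ i * x $ j) / 2"

definition ext_points ::
  "('a::field \<Rightarrow> 'b::field) \<Rightarrow> ('a ^ 'n \<Rightarrow> 'a) \<Rightarrow> ('a ^ 'n) set set \<Rightarrow> ('b ^ 'n) set set" where
  "ext_points h Q L = {P \<in> quadric_points (ext_form h Q). \<exists>l\<in>L. P \<subseteq> ext_line h l}"

lemma polar_form_commute: "polar_form Q x y = polar_form Q y x"
  by (simp add: polar_form_def add.commute)

lemma polar_form_sum_left:
  assumes "quadratic_form Q"
  shows "polar_form Q (\<Sum>i\<in>I. f i) z = (\<Sum>i\<in>I. polar_form Q (f i) z)"
proof -
  have z: "polar_form Q 0 z = 0"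
    using assms unfolding quadratic_form_def by (metis vec.scale_zero_left mult_zero_left)
  show ?thesis
    using assms z unfolding quadratic_form_def by (induction I rule: infinite_finite_induct) auto
qed

lemma quadratic_form_expand:
  fixes Q :: "'f::field ^ 'n \<Rightarrow> 'f"
  assumes Q: "quadratic_form Q" and two: "(2::'f) \<noteq> 0"
  shows "Q x = (\<Sum>i\<in>UNIV. \<Sum>j\<in>UNIV. polar_form Q (axis i 1) (axis j 1) * x $ i * x $ j) / 2"
proof -
  have sc: "polar_form Q (c *s u) v = c * polar_form Q u v" for c u v
    using Q unfolding quadratic_form_def by blast
  have ex: "polar_form Q x z = (\<Sum>i\<in>UNIV. x $ i * polar_form Q (axis i 1) z)" for z
    using polar_form_sum_left[OF Q, of "\<lambda>i. x $ i *s axis i 1" UNIV z]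
    by (simp add: basis_expansion sc)
  have "polar_form Q x x =
      (\<Sum>i\<in>UNIV. x $ i * (\<Sum>j\<in>UNIV. x $ j * polar_form Q (axis j 1) (axis i 1)))"
    by (subst ex, subst polar_form_commute, subst ex) simp
  also have "\<dots> = (\<Sum>i\<in>UNIV. \<Sum>j\<in>UNIV. polar_form Q (axis i 1) (axis j 1) * x $ i * x $ j)"
    by (simp add: sum_distrib_left polar_form_commute mult_ac)
  finally have *: "polar_form Q x x = \<dots>" .
  have "x + x = 2 *s x" by (metis one_add_one vec.scale_left_distrib vec.scale_one)
  then have "polar_form Q x x = 2\<^sup>2 * Q x - Q x - Q x"
    using Q unfolding quadratic_form_def polar_form_def by metis
  then have "polar_form Q x x = 2 * Q x" by (simp add: algebra_simps)
  with * two show ?thesis by (simp add: field_simps)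
qed

lemma field_embedding_zero: "field_embedding h \<Longrightarrow> h 0 = 0"
  unfolding field_embedding_def by (metis add_cancel_right_right)

lemma field_embedding_two: "field_embedding h \<Longrightarrow> h 2 = 2"
  unfolding field_embedding_def by (metis one_add_one)

lemma field_embedding_eq_zero:
  assumes "field_embedding h" shows "h x = 0 \<longleftrightarrow> x = 0"
proof
  assume "h x = 0"
  show "x = 0"
  proof (rule ccontr)
    assume "x \<noteq> 0"
    then have "h x * h (inverse x) = 1"
      using assms unfolding field_embedding_def by (metis right_inverse)
    with \<open>h x = 0\<close> show False by simp
  qed
qed (simp add: field_embedding_zero[OF assms])

lemma field_embedding_sum:
  "field_embedding h \<Longrightarrow> h (\<Sum>i\<in>I. f i) = (\<Sum>i\<in>I. h (f i))"
  by (induction I rule: infinite_finite_induct)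
     (simp_all add: field_embedding_zero, simp add: field_embedding_def)

lemma ext_form_ext_vec:
  fixes Q :: "'a::field ^ 'n \<Rightarrow> 'a" and h :: "'a \<Rightarrow> 'b::field"
  assumes Q: "quadratic_form Q" and h: "field_embedding h" and two: "(2::'a) \<noteq> 0"
  shows "ext_form h Q (ext_vec h x) = h (Q x)"
proof -
  let ?S = "\<Sum>i\<in>UNIV. \<Sum>j\<in>UNIV. polar_form Q (axis i 1) (axis j 1) * x $ i * x $ j"
  have m: "h (u * v) = h u * h v" for u v using h unfolding field_embedding_def by blast
  have two': "(2::'b) \<noteq> 0"
    using field_embedding_eq_zero[OF h, of 2] two field_embedding_two[OF h] by simp
  have "2 * Q x = ?S" using quadratic_form_expand[OF Q two, of x] two by (simp add: mult.commute[of 2])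
  then have "2 * h (Q x) = h ?S" by (metis m field_embedding_two[OF h])
  also have "\<dots> = 2 * ext_form h Q (ext_vec h x)"
    using two' by (simp add: ext_form_def ext_vec_def field_embedding_sum[OF h] m)
  finally show ?thesis using two' by simp
qed

lemma quadratic_form_ext_form:
  fixes Q :: "'a::field ^ 'n \<Rightarrow> 'a" and h :: "'a \<Rightarrow> 'b::field"
  shows "quadratic_form (ext_form h Q)"
proof -
  let ?a = "\<lambda>i j. h (polar_form Q (axis i 1) (axis j 1))"
  have p: "polar_form (ext_form h Q) x y =
      (\<Sum>i\<in>UNIV. \<Sum>j\<in>UNIV. ?a i j * (x $ i * y $ j + y $ i * x $ j)) / 2" for x y
    unfolding polar_form_def ext_form_def diff_divide_distrib[symmetric] sum_subtractf[symmetric]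
    by (simp add: algebra_simps)
  show ?thesis
    unfolding quadratic_form_def p add_divide_distrib[symmetric] sum.distrib[symmetric]
    by (auto simp: ext_form_def sum_distrib_left sum_divide_distrib algebra_simps power2_eq_square)
qed

lemma ext_form_unique:
  fixes Q :: "'a::field ^ 'n \<Rightarrow> 'a" and h :: "'a \<Rightarrow> 'b::field"
  assumes Q: "quadratic_form Q" and h: "field_embedding h" and two: "(2::'a) \<noteq> 0"
    and Q': "quadratic_form Q'" and agree: "\<And>x. Q' (ext_vec h x) = h (Q x)"
  shows "Q' = ext_form h Q"
proof
  fix x
  have two': "(2::'b) \<noteq> 0"
    using field_embedding_eq_zero[OF h, of 2] two field_embedding_two[OF h] by simp
  have a: "h (u + v) = h u + h v" for u v using h unfolding field_embedding_def by blast
  have d: "h (u - v) = h u - h v" for u v using a[of "u - v" v] by simp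
  have v: "ext_vec h (u + w) = ext_vec h u + ext_vec h w" for u w :: "'a ^ 'n"
    by (simp add: ext_vec_def a vec_eq_iff)
  have ax: "ext_vec h (axis i 1 :: 'a ^ 'n) = axis i 1" for i
    using h field_embedding_zero[OF h]
    by (auto simp: ext_vec_def axis_def vec_eq_iff field_embedding_def)
  have "polar_form Q' (ext_vec h u) (ext_vec h w) = h (polar_form Q u w)" for u w
    unfolding polar_form_def d v[symmetric] agree by simp
  from this[of "axis _ 1" "axis _ 1"]
  show "Q' x = ext_form h Q x"
    unfolding ext_form_def by (subst quadratic_form_expand[OF Q' two']) (simp add: ax)
qed

end

theory Submission
  imports Defs
begin

text \<open>Write a point of the large quadric as \<open>P = \<langle>a + \<omega> b\<rangle>\<close> with \<open>a\<close>, \<open>b\<close> over the small field and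
  \<open>\<omega>\<^sup>2 = s\<close> a nonsquare. With \<open>U = {a, b}\<^sup>\<bottom>\<close>, counting the flags of a line of \<open>L\<close> and a point of \<open>P\<^sup>\<bottom>\<close>
  on its extension expresses \<open>|P\<^sup>\<bottom> \<inter> X|\<close> as \<open>q\<^sup>2 A + |L| - (m - 1) N\<close>, where \<open>A\<close> and \<open>N\<close> are the numbers
  of lines of \<open>L\<close> and of singular points inside \<open>U\<close>. The rank of the form on \<open>U\<close> is odd in all cases, so
  \<open>N\<close> depends only on the dimension of \<open>U\<close>. If \<open>P\<close> is a small point, the covering property also
  determines \<open>A\<close>, and the tightness equation holds automatically. Otherwise \<open>P\<close> is imaginary:
  \<open>a\<close> and \<open>b\<close> span a line of the small space that is totally singular or anisotropic, every such line arises, and the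
  tightness equation at \<open>P\<close> is the condition on \<open>A\<close> for this line.\<close>

section \<open>Squares and subspaces over a finite field\<close>

text \<open>If 2 = 0, translation by 1 is an involution without fixed points, so its orbits
  \<open>{x, x + 1}\<close> pair off the elements and the order of the field is even.\<close>

lemma two_neq_zero_of_odd_card:
  assumes "odd CARD('a::{field,finite})"
  shows "(2::'a) \<noteq> 0"
proof
  assume two: "(2::'a) = 0"
  then have inv: "x + 1 + 1 = x" for x :: 'a by (simp add: add.assoc)
  let ?C = "range (\<lambda>x::'a. {x, x + 1})"
  have "2 * card ?C = card (\<Union>?C)"
  proof (rule card_partition)
    fix c1 c2 assume c: "c1 \<in> ?C" "c2 \<in> ?C" "c1 \<noteq> c2"
    have "d = {z, z + 1}" if dz: "d \<in> ?C" "z \<in> d" for d z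
    proof -
      obtain x where d: "d = {x, x + 1}" using dz by blast
      then consider "z = x" | "z = x + 1" using dz by blast
      then show ?thesis
      proof cases
        case 2
        then have "z + 1 = x" by (simp only: inv)
        with 2 d show ?thesis by (simp only: insert_commute)
      qed (simp add: d)
    qed
    with c show "c1 \<inter> c2 = {}" by (metis disjoint_iff)
  qed auto
  moreover have "\<Union>?C = UNIV" by auto
  ultimately show False using assms by (metis dvd_triv_left)
qed

text \<open>Squaring has one preimage over 0 and two, \<open>x\<close> and \<open>- x\<close>, over
  every other square.\<close>

lemma card_squares:
  assumes two: "(2::'a::{field,finite}) \<noteq> 0"
  shows "2 * card (range (\<lambda>x::'a. x\<^sup>2)) = CARD('a) + 1"
proof -
  let ?S = "range (\<lambda>x::'a. x\<^sup>2)"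
  have root: "card {x. x\<^sup>2 = t} = 2" if t: "t \<in> ?S - {0}" for t
  proof -
    obtain x where x: "t = x\<^sup>2" "x \<noteq> 0" using t by auto
    have "x \<noteq> - x"
    proof
      assume "x = - x"
      then have "2 * x = 0" by (metis add.right_inverse mult_2)
      with two x show False by simp
    qed
    moreover have "{y. y\<^sup>2 = t} = {x, - x}" using x by (auto simp: power2_eq_iff)
    ultimately show ?thesis by simp
  qed
  have "UNIV = (\<Union>t\<in>?S. {x. x\<^sup>2 = t})" by auto
  then have "CARD('a) = card (\<Union>t\<in>?S. {x. x\<^sup>2 = t})" by metis
  also have "\<dots> = (\<Sum>t\<in>?S. card {x. x\<^sup>2 = t})"
    by (rule card_UN_disjoint) auto
  also have "\<dots> = card {x::'a. x\<^sup>2 = 0} + (\<Sum>t\<in>?S - {0}. card {x. x\<^sup>2 = t})"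
    by (rule sum.remove) (auto intro: image_eqI[of _ _ 0])
  also have "\<dots> = 1 + 2 * card (?S - {0})" using root by simp
  also have "card (?S - {0}) = card ?S - 1"
    by (rule card_Diff_singleton) (auto intro: image_eqI[of _ _ 0])
  finally have "CARD('a) = 1 + 2 * (card ?S - 1)" .
  moreover have "card ?S > 0" by (simp add: card_gt_0_iff)
  ultimately show ?thesis by linarith
qed

text \<open>The squares and their multiples by \<open>s\<close> are two sets of (q + 1) / 2
  elements, q being the order of the field. They share only 0, as another common element would make
  \<open>s\<close> a square. Hence they fill the field, and \<open>t\<close> lies in the
  second.\<close>

lemma nonsquares_ratio_square:
  fixes s t :: "'a::{field,finite}"
  assumes two: "(2::'a) \<noteq> 0" and s: "\<And>x. x\<^sup>2 \<noteq> s" and t: "\<And>x. x\<^sup>2 \<noteq> t"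
  obtains x where "t = s * x\<^sup>2"
proof -
  let ?S = "range (\<lambda>x::'a. x\<^sup>2)"
  have s0: "s \<noteq> 0" using s[of 0] by auto
  have t0: "t \<noteq> 0" using t[of 0] by auto
  have c: "card ((\<lambda>u. s * u) ` ?S) = card ?S" using s0 by (intro card_image) (auto simp: inj_on_def)
  have "?S \<inter> (\<lambda>u. s * u) ` ?S = {0}"
  proof
    show "?S \<inter> (\<lambda>u. s * u) ` ?S \<subseteq> {0}"
    proof
      fix u assume "u \<in> ?S \<inter> (\<lambda>u. s * u) ` ?S"
      then obtain x y where xy: "u = x\<^sup>2" "u = s * y\<^sup>2" by blast
      have "(x / y)\<^sup>2 = s" if "y \<noteq> 0" using xy that by (simp add: field_simps)
      with s have "y = 0" by blast
      with xy show "u \<in> {0}" by simp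
    qed
  qed (auto intro: image_eqI[of _ _ 0])
  then have "card (?S \<union> (\<lambda>u. s * u) ` ?S) + 1 = card ?S + card ?S"
    using card_Un_Int[of ?S "(\<lambda>u. s * u) ` ?S"] c by simp
  with card_squares[OF two] have "card (?S \<union> (\<lambda>u. s * u) ` ?S) = CARD('a)" by linarith
  then have U: "?S \<union> (\<lambda>u. s * u) ` ?S = UNIV" by (intro card_subset_eq) simp_all
  have "t \<in> ?S \<union> (\<lambda>u. s * u) ` ?S" unfolding U by (rule UNIV_I)
  then obtain x where "t = s * x\<^sup>2" using t by blast
  then show ?thesis by (rule that)
qed

text \<open>Pigeonhole: the values \<open>a * x\<^sup>2\<close> and the values
  \<open>c - b * y\<^sup>2\<close> form two sets of (q + 1) / 2 elements each, too large to be
  disjoint.\<close>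

lemma binary_diagonal_form_universal:
  fixes a b c :: "'a::{field,finite}"
  assumes two: "(2::'a) \<noteq> 0" and "a \<noteq> 0" "b \<noteq> 0"
  obtains x y where "a * x\<^sup>2 + b * y\<^sup>2 = c"
proof -
  let ?S = "range (\<lambda>x::'a. x\<^sup>2)"
  have 1: "card ((\<lambda>u. a * u) ` ?S) = card ?S" using assms by (intro card_image) (auto simp: inj_on_def)
  have 2: "card ((\<lambda>u. c - b * u) ` ?S) = card ?S"
    using assms by (intro card_image) (auto simp: inj_on_def)
  have "(\<lambda>u. a * u) ` ?S \<inter> (\<lambda>u. c - b * u) ` ?S \<noteq> {}"
  proof
    assume e: "(\<lambda>u. a * u) ` ?S \<inter> (\<lambda>u. c - b * u) ` ?S = {}"
    have "card ((\<lambda>u. a * u) ` ?S \<union> (\<lambda>u. c - b * u) ` ?S) = card ?S + card ?S"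
      using card_Un_disjoint[OF _ _ e] 1 2 by simp
    moreover have "card ((\<lambda>u. a * u) ` ?S \<union> (\<lambda>u. c - b * u) ` ?S) \<le> CARD('a)"
      by (rule card_mono) auto
    ultimately show False using card_squares[OF two] by linarith
  qed
  then obtain x y where "a * x\<^sup>2 = c - b * y\<^sup>2" by blast
  then have "a * x\<^sup>2 + b * y\<^sup>2 = c" by simp
  then show ?thesis by (rule that)
qed

section \<open>Cardinalities of subspaces and of their sets of points\<close>

lemma card_span_independent:
  fixes B :: "('a::{field,finite} ^ 'n) set"
  assumes "vec.independent B"
  shows "card (vec.span B) = CARD('a) ^ card B"
proof -
  have "finite B" by simp
  then show ?thesis using assms
  proof (induction B)
    case (insert b B)
    have b: "b \<notin> vec.span B" and B: "vec.independent B"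
      using insert by (auto simp: vec.independent_insert)
    have "bij_betw (\<lambda>(k, x). k *s b + x) (UNIV \<times> vec.span B) (vec.span (insert b B))"
    proof (rule bij_betw_imageI)
      have key: "k = l" if e: "k *s b + x = l *s b + y" and x: "x \<in> vec.span B" "y \<in> vec.span B"
        for k l x y
      proof (rule ccontr)
        assume "k \<noteq> l"
        have "(k - l) *s b = y - x" using e by (simp add: algebra_simps vec.scale_left_diff_distrib)
        then have "(k - l) *s b \<in> vec.span B" using x by (simp add: vec.span_diff)
        then have "b \<in> vec.span B"
          using \<open>k \<noteq> l\<close> vec.span_scale[of "(k - l) *s b" B "inverse (k - l)"]
          by (simp only: vec.scale_scale) simp
        with b show False by simp
      qed
      show "inj_on (\<lambda>(k, x). k *s b + x) (UNIV \<times> vec.span B)"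
        using key by (auto simp: inj_on_def) (metis add_left_cancel)
      show "(\<lambda>(k, x). k *s b + x) ` (UNIV \<times> vec.span B) = vec.span (insert b B)"
      proof (intro set_eqI iffI)
        fix z assume "z \<in> vec.span (insert b B)"
        then obtain k where "z - k *s b \<in> vec.span B" by (auto simp: vec.span_insert)
        then show "z \<in> (\<lambda>(k, x). k *s b + x) ` (UNIV \<times> vec.span B)"
          by (intro image_eqI[of _ _ "(k, z - k *s b)"]) simp_all
      next
        fix z assume "z \<in> (\<lambda>(k, x). k *s b + x) ` (UNIV \<times> vec.span B)"
        then obtain k x where "z = k *s b + x" "x \<in> vec.span B" by auto
        then show "z \<in> vec.span (insert b B)"
          by (auto simp: vec.span_insert intro!: exI[of _ k])
      qed
    qed
    then have "card (UNIV \<times> vec.span B :: ('a \<times> _) set) = card (vec.span (insert b B))"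
      by (rule bij_betw_same_card)
    then have "card (vec.span (insert b B)) = CARD('a) * card (vec.span B)"
      by (simp only: card_cartesian_product)
    also have "\<dots> = CARD('a) ^ card (insert b B)"
      unfolding insert.IH[OF B] using insert.hyps by simp
    finally show ?case .
  qed simp
qed

lemma card_subspace:
  fixes U :: "('a::{field,finite} ^ 'n) set"
  assumes "vec.subspace U"
  shows "card U = CARD('a) ^ vec.dim U"
proof -
  obtain B where B: "B \<subseteq> U" "vec.independent B" "U \<subseteq> vec.span B" "card B = vec.dim U"
    by (rule vec.basis_exists)
  moreover have "vec.span B = U"
    using B assms by (metis subset_antisym vec.span_minimal)
  ultimately show ?thesis using card_span_independent by metis
qed

lemma proj_points_iff: "P \<in> proj_points \<longleftrightarrow> (\<exists>x. x \<noteq> 0 \<and> P = vec.span {x})"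
proof
  assume "P \<in> proj_points"
  then have P: "vec.subspace P" "vec.dim P = 1" by (auto simp: proj_points_def)
  obtain B where B: "B \<subseteq> P" "vec.independent B" "P \<subseteq> vec.span B" "card B = vec.dim P"
    by (rule vec.basis_exists)
  obtain x where "B = {x}" using B P by (auto simp: card_1_singleton_iff)
  moreover have "vec.span B = P" using B P by (metis subset_antisym vec.span_minimal)
  ultimately show "\<exists>x. x \<noteq> 0 \<and> P = vec.span {x}" using B by auto
qed (auto simp: proj_points_def vec.dim_singleton)

lemma proj_point_eq_span:
  assumes "P \<in> proj_points" "x \<in> P" "x \<noteq> 0"
  shows "P = vec.span {x}"
proof -
  obtain y where y: "P = vec.span {y}" "y \<noteq> 0" using assms proj_points_iff by auto
  then obtain k where k: "x = k *s y" using assms by (auto simp: vec.span_singleton)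
  then have "k \<noteq> 0" using assms by auto
  then have "y = inverse k *s x" using k by (simp add: vec.scale_scale)
  then have "y \<in> vec.span {x}" by (metis vec.span_base singletonI vec.span_scale)
  then show ?thesis unfolding y(1)
    by (metis assms(2) empty_subsetI insert_subset subset_antisym vec.span_minimal vec.subspace_span y(1))
qed

lemma span_singleton_subset_iff:
  assumes "\<And>c x. x \<in> Z \<Longrightarrow> c *s x \<in> Z"
  shows "vec.span {x} \<subseteq> Z \<longleftrightarrow> x \<in> Z"
proof
  assume "x \<in> Z"
  then have "k *s x \<in> Z" for k by (rule assms)
  then show "vec.span {x} \<subseteq> Z" unfolding vec.span_singleton by blast
qed (use vec.span_base in blast)

text \<open>The nonzero vectors of the cone \<open>Z\<close> are partitioned by the points inside
  \<open>Z\<close>, each of which has q - 1 nonzero vectors. The summand 1 stands for the zero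
  vector.\<close>

lemma card_points_cone:
  fixes Z :: "('a::{field,finite} ^ 'n) set"
  assumes Z: "\<And>c x. x \<in> Z \<Longrightarrow> c *s x \<in> Z" and "Z \<noteq> {}"
  shows "card {P \<in> proj_points. P \<subseteq> Z} * (CARD('a) - 1) + 1 = card Z"
proof -
  let ?C = "{P \<in> proj_points. P \<subseteq> Z}"
  have zero: "0 \<in> Z" using assms by (metis all_not_in_conv vec.scale_zero_left)
  have c1: "card (P - {0}) = CARD('a) - 1" if "P \<in> proj_points" for P :: "('a ^ 'n) set"
  proof -
    have P: "vec.subspace P" "vec.dim P = 1" using that by (auto simp: proj_points_def)
    then have "card P = CARD('a)" using card_subspace[of P] by simp
    moreover have "0 \<in> P" using P vec.subspace_0 by blast
    ultimately show ?thesis by simp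
  qed
  have dis: "(P - {0}) \<inter> (R - {0}) = {}" if "P \<in> ?C" "R \<in> ?C" "P \<noteq> R" for P R
    using that proj_point_eq_span by blast
  have un: "Z - {0} = (\<Union>P\<in>?C. P - {0})"
  proof -
    have "\<exists>P\<in>?C. x \<in> P" if "x \<in> Z" "x \<noteq> 0" for x
      using that span_singleton_subset_iff[of Z x, OF Z]
      by (intro bexI[of _ "vec.span {x}"]) (auto simp: proj_points_iff vec.span_base)
    then show ?thesis by auto
  qed
  have "card (Z - {0}) = (\<Sum>P\<in>?C. card (P - {0}))"
    unfolding un using dis by (intro card_UN_disjoint) auto
  also have "\<dots> = card ?C * (CARD('a) - 1)" using c1 by simp
  finally have "card (Z - {0}) = card ?C * (CARD('a) - 1)" .
  moreover have "card Z = card (Z - {0}) + 1"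
    using zero by (metis Suc_eq_plus1 card.remove finite)
  ultimately show ?thesis by simp
qed

lemma card_field_ge_2: "CARD('a::{field,finite}) \<ge> 2"
proof -
  have "card {0, 1 :: 'a} \<le> CARD('a)" by (rule card_mono) auto
  then show ?thesis by simp
qed

lemma card_points_subspace:
  fixes U :: "('a::{field,finite} ^ 'n) set"
  assumes "vec.subspace U"
  shows "vec.dim U = 1 \<Longrightarrow> card {P \<in> proj_points. P \<subseteq> U} = 1"
    and "vec.dim U = 2 \<Longrightarrow> card {P \<in> proj_points. P \<subseteq> U} = CARD('a) + 1"
proof -
  \<comment> \<open>This turns the truncated difference q - 1 into \<open>p + 1\<close>, a positive
    factor that can be cancelled.\<close>
  obtain p where p: "CARD('a) = p + 2" using card_field_ge_2[where 'a='a] by (metis le_Suc_ex add.commute)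
  have *: "card {P \<in> proj_points. P \<subseteq> U} * (CARD('a) - 1) + 1 = CARD('a) ^ vec.dim U"
    using card_points_cone[of U] assms card_subspace[OF assms] vec.subspace_0 vec.subspace_scale
    by (metis empty_iff)
  show "card {P \<in> proj_points. P \<subseteq> U} = 1" if "vec.dim U = 1"
  proof -
    have "card {P \<in> proj_points. P \<subseteq> U} * (p + 1) = 1 * (p + 1)" using * that by (simp add: p)
    then show ?thesis by (subst (asm) mult_cancel2) auto
  qed
  show "card {P \<in> proj_points. P \<subseteq> U} = CARD('a) + 1" if "vec.dim U = 2"
  proof -
    have "card {P \<in> proj_points. P \<subseteq> U} * (p + 1) = (p + 3) * (p + 1)"
      using * that by (simp add: p power2_eq_square algebra_simps)
    then have "card {P \<in> proj_points. P \<subseteq> U} = p + 3" by (subst (asm) mult_cancel2) auto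
    then show ?thesis by (simp add: p)
  qed
qed

section \<open>Singular vectors of a form of odd rank\<close>

lemma polar_form_add_left:
  "quadratic_form Q \<Longrightarrow> polar_form Q (x + y) z = polar_form Q x z + polar_form Q y z"
  unfolding quadratic_form_def by blast

lemma polar_form_scale_left:
  "quadratic_form Q \<Longrightarrow> polar_form Q (c *s x) z = c * polar_form Q x z"
  unfolding quadratic_form_def by blast

lemma polar_form_add_right:
  "quadratic_form Q \<Longrightarrow> polar_form Q z (x + y) = polar_form Q z x + polar_form Q z y"
  by (simp add: polar_form_commute[of Q z] polar_form_add_left)

lemma polar_form_scale_right:
  "quadratic_form Q \<Longrightarrow> polar_form Q z (c *s x) = c * polar_form Q z x"
  by (simp add: polar_form_commute[of Q z] polar_form_scale_left)

lemma polar_form_zero: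
  assumes "quadratic_form Q"
  shows "polar_form Q 0 z = 0" "polar_form Q z 0 = 0"
  using polar_form_scale_left[OF assms, of 0 0] polar_form_scale_right[OF assms, of _ 0 0] by auto

lemma polar_form_diff_right:
  "quadratic_form Q \<Longrightarrow> polar_form Q z (x - y) = polar_form Q z x - polar_form Q z y"
  using polar_form_add_right[of Q z "x - y" y] by simp

lemmas polar_form_bilinear =
  polar_form_add_left polar_form_add_right polar_form_scale_left polar_form_scale_right
  polar_form_diff_right polar_form_zero

lemma quadratic_form_scale: "quadratic_form Q \<Longrightarrow> Q (c *s x) = c\<^sup>2 * Q x"
  unfolding quadratic_form_def by blast

lemma quadratic_form_zero: "quadratic_form Q \<Longrightarrow> Q 0 = 0"
  using quadratic_form_scale[of Q 0 0] by simp

lemma quadratic_form_add: "Q (x + y) = Q x + Q y + polar_form Q x y"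
  by (simp add: polar_form_def)

lemma polar_form_self:
  assumes "quadratic_form Q"
  shows "polar_form Q x x = 2 * Q x"
proof -
  have "x + x = 2 *s x" by (metis one_add_one vec.scale_left_distrib vec.scale_one)
  then have "polar_form Q x x = 2\<^sup>2 * Q x - Q x - Q x"
    using quadratic_form_scale[OF assms, of 2 x] by (simp add: polar_form_def)
  then show ?thesis by (simp add: algebra_simps)
qed

section \<open>Orthogonal complements and radicals\<close>

lemma subspace_perp: "quadratic_form Q \<Longrightarrow> vec.subspace (perp Q S)"
  by (rule vec.subspaceI) (auto simp: perp_def polar_form_bilinear)

lemma perp_span:
  assumes "quadratic_form Q"
  shows "perp Q (vec.span S) = perp Q S"
proof
  show "perp Q (vec.span S) \<subseteq> perp Q S" using vec.span_superset by (auto simp: perp_def)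
  show "perp Q S \<subseteq> perp Q (vec.span S)"
  proof
    fix y assume "y \<in> perp Q S"
    then have "S \<subseteq> perp Q {y}" by (auto simp: perp_def polar_form_commute)
    then have "vec.span S \<subseteq> perp Q {y}"
      using subspace_perp[OF assms] by (rule vec.span_minimal)
    then show "y \<in> perp Q (vec.span S)" by (auto simp: perp_def polar_form_commute)
  qed
qed

lemma mem_perp_singleton: "y \<in> perp Q {x} \<longleftrightarrow> polar_form Q x y = 0"
  by (simp add: perp_def)

text \<open>This is the projection of \<open>z\<close> along \<open>u\<close> onto the hyperplane
  orthogonal to \<open>w\<close>; \<open>w\<close> itself may lie outside \<open>U\<close>.\<close>

lemma hyperplane_decomposition:
  assumes Q: "quadratic_form Q" and U: "vec.subspace U" and u: "u \<in> U" "polar_form Q w u \<noteq> 0"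
    and z: "z \<in> U"
  shows "z - (polar_form Q w z / polar_form Q w u) *s u \<in> U \<inter> perp Q {w}"
  using assms by (simp add: mem_perp_singleton polar_form_bilinear vec.subspace_diff vec.subspace_scale)

lemma dim_inter_perp:
  fixes U :: "('a::{field,finite} ^ 'n) set"
  assumes Q: "quadratic_form Q" and U: "vec.subspace U" and u: "u \<in> U" "polar_form Q w u \<noteq> 0"
  shows "vec.dim (U \<inter> perp Q {w}) + 1 = vec.dim U"
proof -
  let ?H = "U \<inter> perp Q {w}"
  have H: "vec.subspace ?H" using U subspace_perp[OF Q] by (rule vec.subspace_inter)
  have "u \<notin> vec.span ?H"
    unfolding vec.span_eq_iff[THEN iffD2, OF H] using u by (simp add: mem_perp_singleton)
  then have "vec.dim (insert u ?H) = vec.dim ?H + 1" by (simp add: vec.dim_insert)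
  moreover have "vec.span (insert u ?H) = U"
  proof
    show "vec.span (insert u ?H) \<subseteq> U" using U u by (intro vec.span_minimal) auto
    show "U \<subseteq> vec.span (insert u ?H)"
      unfolding vec.span_insert
      using hyperplane_decomposition[OF Q U u] vec.span_base by blast
  qed
  ultimately show ?thesis by (metis vec.dim_span)
qed

text \<open>This is the radical of the polar form restricted to \<open>U\<close>; its codimension in
  \<open>U\<close> is the rank of the restricted form.\<close>

definition form_radical :: "('f::field ^ 'n \<Rightarrow> 'f) \<Rightarrow> ('f ^ 'n) set \<Rightarrow> ('f ^ 'n) set" where
  "form_radical Q U = U \<inter> perp Q U"

lemma subspace_radical: "quadratic_form Q \<Longrightarrow> vec.subspace U \<Longrightarrow> vec.subspace (form_radical Q U)"
  unfolding form_radical_def by (intro vec.subspace_inter subspace_perp)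

lemma mem_radical: "z \<in> form_radical Q U \<longleftrightarrow> z \<in> U \<and> (\<forall>x\<in>U. polar_form Q x z = 0)"
  by (auto simp: form_radical_def perp_def)

text \<open>A nonsingular \<open>x\<close> splits off: \<open>U\<close> is the orthogonal sum of its
  span and the hyperplane section, so a vector orthogonal to both is orthogonal to
  \<open>U\<close>.\<close>

lemma radical_inter_perp_nonsingular:
  fixes U :: "('a::field ^ 'n) set"
  assumes Q: "quadratic_form Q" and two: "(2::'a) \<noteq> 0" and U: "vec.subspace U"
    and x: "x \<in> U" "Q x \<noteq> 0"
  shows "form_radical Q (U \<inter> perp Q {x}) = form_radical Q U"
proof -
  have xx: "polar_form Q x x \<noteq> 0" using x two by (simp add: polar_form_self[OF Q])
  have *: "polar_form Q u z = 0"
    if u: "u \<in> U" and z: "z \<in> form_radical Q (U \<inter> perp Q {x})" for u z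
  proof -
    have "polar_form Q (u - (polar_form Q x u / polar_form Q x x) *s x) z = 0"
      using hyperplane_decomposition[OF Q U x(1) xx u] z by (simp add: mem_radical)
    moreover have "polar_form Q x z = 0" using z by (simp add: mem_radical mem_perp_singleton)
    ultimately show ?thesis
      by (simp add: polar_form_commute[of Q _ z] polar_form_bilinear[OF Q])
  qed
  show ?thesis
  proof (intro set_eqI iffI)
    fix z assume z: "z \<in> form_radical Q (U \<inter> perp Q {x})"
    then have "z \<in> U" by (simp add: mem_radical)
    with *[OF _ z] show "z \<in> form_radical Q U" unfolding mem_radical by blast
  qed (use x in \<open>simp add: mem_radical mem_perp_singleton\<close>)
qed

text \<open>A singular \<open>x\<close> lies in its own perp and is orthogonal to the whole section,
  so it joins the radical. Any radical vector of the section becomes radical in \<open>U\<close>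
  after subtracting a multiple of \<open>x\<close>.\<close>

lemma radical_inter_perp_singular:
  fixes U :: "('a::field ^ 'n) set"
  assumes Q: "quadratic_form Q" and two: "(2::'a) \<noteq> 0" and U: "vec.subspace U"
    and x: "x \<in> U" "x \<notin> form_radical Q U" "Q x = 0"
  shows "form_radical Q (U \<inter> perp Q {x}) = vec.span (insert x (form_radical Q U))"
proof
  obtain y where y: "y \<in> U" "polar_form Q x y \<noteq> 0"
    using x by (auto simp: mem_radical polar_form_commute)
  have xx: "polar_form Q x x = 0" using x by (simp add: polar_form_self[OF Q])
  show "form_radical Q (U \<inter> perp Q {x}) \<subseteq> vec.span (insert x (form_radical Q U))"
  proof
    fix z assume z: "z \<in> form_radical Q (U \<inter> perp Q {x})"
    \<comment> \<open>With this value \<open>z - k *s x\<close> is orthogonal to \<open>y\<close> as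
      well, and \<open>y\<close> together with the section spans \<open>U\<close>.\<close>
    define k where "k = polar_form Q y z / polar_form Q x y"
    have "z - k *s x \<in> form_radical Q U"
      unfolding mem_radical
    proof (intro conjI ballI)
      show "z - k *s x \<in> U" using z x U by (simp add: mem_radical vec.subspace_diff vec.subspace_scale)
      fix u assume u: "u \<in> U"
      let ?v = "u - (polar_form Q x u / polar_form Q x y) *s y"
      have v: "?v \<in> U \<inter> perp Q {x}" by (rule hyperplane_decomposition[OF Q U y u])
      then have "polar_form Q ?v z = 0" "polar_form Q x ?v = 0"
        using z by (simp_all add: mem_radical mem_perp_singleton)
      then have "polar_form Q z ?v - k * polar_form Q x ?v = 0"
        by (simp add: polar_form_commute[of Q ?v])
      then show "polar_form Q u (z - k *s x) = 0"
        using y(2) by (simp add: polar_form_commute[of Q u] polar_form_bilinear[OF Q]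
            polar_form_commute[of Q y] k_def)
    qed
    then show "z \<in> vec.span (insert x (form_radical Q U))"
      unfolding vec.span_insert using vec.span_base by blast
  qed
  show "vec.span (insert x (form_radical Q U)) \<subseteq> form_radical Q (U \<inter> perp Q {x})"
  proof (rule vec.span_minimal)
    show "insert x (form_radical Q U) \<subseteq> form_radical Q (U \<inter> perp Q {x})"
      using x xx by (auto simp: mem_radical mem_perp_singleton polar_form_commute)
    show "vec.subspace (form_radical Q (U \<inter> perp Q {x}))"
      using Q U by (intro subspace_radical vec.subspace_inter subspace_perp)
  qed
qed

lemma dim_inter_perp_nonradical:
  fixes U :: "('a::{field,finite} ^ 'n) set"
  assumes "quadratic_form Q" "vec.subspace U" "x \<in> U" "x \<notin> form_radical Q U"
  shows "vec.dim (U \<inter> perp Q {x}) + 1 = vec.dim U"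
proof -
  obtain y where "y \<in> U" "polar_form Q x y \<noteq> 0"
    using assms by (auto simp: mem_radical polar_form_commute)
  with assms show ?thesis by (intro dim_inter_perp)
qed

text \<open>As the section loses one dimension, the rank drops by two, and the sum of the two
  dimensions keeps its parity.\<close>

lemma dim_radical_inter_perp_singular:
  fixes U :: "('a::field ^ 'n) set"
  assumes "quadratic_form Q" "(2::'a) \<noteq> 0" "vec.subspace U"
    "x \<in> U" "x \<notin> form_radical Q U" "Q x = 0"
  shows "vec.dim (form_radical Q (U \<inter> perp Q {x})) = vec.dim (form_radical Q U) + 1"
proof -
  have "vec.span (form_radical Q U) = form_radical Q U"
    using assms by (simp add: subspace_radical)
  then show ?thesis
    unfolding radical_inter_perp_singular[OF assms] vec.dim_span vec.dim_insert
    using assms(5) by (simp only: if_False)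
qed

lemma nonsingular_not_in_radical:
  fixes U :: "('a::field ^ 'n) set"
  assumes "quadratic_form Q" "(2::'a) \<noteq> 0" "Q x \<noteq> 0"
  shows "x \<notin> form_radical Q U"
  using assms polar_form_self[OF assms(1), of x] by (auto simp: mem_radical intro!: bexI[of _ x])

text \<open>Assumption \<open>sing\<close> says that the form is anisotropic modulo its radical. Its
  rank is then at most 2, because three mutually orthogonal nonsingular vectors have a singular
  combination outside the radical; oddness leaves rank 1.\<close>

lemma dim_eq_radical_plus_one:
  fixes U :: "('a::{field,finite} ^ 'n) set"
  assumes Q: "quadratic_form Q" and two: "(2::'a) \<noteq> 0" and U: "vec.subspace U"
    and sing: "\<And>x. x \<in> U \<Longrightarrow> Q x = 0 \<Longrightarrow> x \<in> form_radical Q U"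
    and odd: "odd (vec.dim U + vec.dim (form_radical Q U))"
  shows "vec.dim U = vec.dim (form_radical Q U) + 1"
proof -
  let ?R = "form_radical Q U"
  have RU: "?R \<subseteq> U" by (simp add: form_radical_def)
  have le: "vec.dim ?R \<le> vec.dim U" using RU by (rule vec.dim_subset)
  have "\<not> U \<subseteq> ?R"
  proof
    assume "U \<subseteq> ?R"
    then have "?R = U" using RU by blast
    then show False using odd by simp
  qed
  then obtain e1 where e1: "e1 \<in> U" "e1 \<notin> ?R" by blast
  let ?U1 = "U \<inter> perp Q {e1}"
  have d1: "vec.dim ?U1 + 1 = vec.dim U" by (rule dim_inter_perp_nonradical[OF Q U e1])
  have s1: "vec.subspace ?U1" using U Q by (intro vec.subspace_inter subspace_perp)
  have R1: "form_radical Q ?U1 = ?R"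
    using e1 sing by (intro radical_inter_perp_nonsingular[OF Q two U]) auto
  show ?thesis
  proof (cases "?U1 \<subseteq> ?R")
    case True
    then have "?U1 = ?R" using R1 by (auto simp: mem_radical)
    then show ?thesis using d1 by simp
  next
    case False
    then obtain e2 where e2: "e2 \<in> ?U1" "e2 \<notin> ?R" by blast
    let ?U2 = "?U1 \<inter> perp Q {e2}"
    have d2: "vec.dim ?U2 + 1 = vec.dim ?U1"
      using dim_inter_perp_nonradical[OF Q s1 e2(1)] e2(2) R1 by simp
    have "form_radical Q ?U2 = form_radical Q ?U1"
      using e2 sing by (intro radical_inter_perp_nonsingular[OF Q two s1]) auto
    then have R2: "form_radical Q ?U2 = ?R" using R1 by simp
    \<comment> \<open>Otherwise the rank would be 2, against the parity assumption.\<close>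
    have "\<not> ?U2 \<subseteq> ?R"
    proof
      assume "?U2 \<subseteq> ?R"
      then have "?U2 = ?R" using R2 by (auto simp: mem_radical)
      then show False using d1 d2 odd by (metis odd_even_add even_add odd_one add.assoc)
    qed
    then obtain e3 where e3: "e3 \<in> ?U2" "e3 \<notin> ?R" by blast
    have ns: "Q e1 \<noteq> 0" "Q e2 \<noteq> 0" "Q e3 \<noteq> 0" using e1 e2 e3 sing by blast+
    \<comment> \<open>The coefficients make \<open>?v\<close> singular, hence radical and orthogonal
      to \<open>e3\<close>; but its product with \<open>e3\<close> is twice
      \<open>Q e3\<close>.\<close>
    obtain a b where ab: "Q e1 * a\<^sup>2 + Q e2 * b\<^sup>2 = - Q e3"
      using binary_diagonal_form_universal[OF two ns(1,2)] by metis
    let ?v = "a *s e1 + b *s e2 + e3"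
    have o: "polar_form Q e1 e2 = 0" "polar_form Q e1 e3 = 0" "polar_form Q e2 e3 = 0"
      using e2 e3 by (auto simp: mem_perp_singleton)
    have "Q ?v = a\<^sup>2 * Q e1 + b\<^sup>2 * Q e2 + Q e3"
      by (simp add: quadratic_form_add quadratic_form_scale[OF Q] polar_form_bilinear[OF Q] o)
    then have "Q ?v = 0" using ab by (simp add: mult.commute)
    moreover have "?v \<in> U" using e1 e2 e3 U by (intro vec.subspace_add vec.subspace_scale) auto
    ultimately have "?v \<in> ?R" by (intro sing)
    then have "polar_form Q ?v e3 = 0"
      using e3 by (auto simp: mem_radical polar_form_commute)
    then have "2 * Q e3 = 0" by (simp add: polar_form_bilinear[OF Q] o polar_form_self[OF Q])
    with two ns(3) show ?thesis by simp
  qed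
qed

text \<open>For singular \<open>x\<close> the value of \<open>Q\<close> at \<open>u + t *s x\<close>
  is affine in \<open>t\<close>, with slope \<open>polar_form Q u x\<close>, which is nonzero off
  the perp of \<open>x\<close>. So there is exactly one root on each parallel.\<close>

lemma card_singular_vectors_step:
  fixes U :: "('a::{field,finite} ^ 'n) set"
  assumes Q: "quadratic_form Q" and U: "vec.subspace U" and x: "x \<in> U" "Q x = 0"
  shows "CARD('a) * card {u \<in> U - perp Q {x}. Q u = 0} = card (U - perp Q {x})"
proof -
  let ?S = "{u \<in> U - perp Q {x}. Q u = 0}"
  let ?f = "\<lambda>(t, u). u + t *s x"
  have px: "polar_form Q x x = 0" using x by (simp add: polar_form_self[OF Q])
  have "bij_betw ?f (UNIV \<times> ?S) (U - perp Q {x})"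
  proof (rule bij_betw_imageI)
    show "inj_on ?f (UNIV \<times> ?S)"
    proof (rule inj_onI, clarify)
      fix s t u v
      assume u: "u \<notin> perp Q {x}" "Q u = 0" and v: "Q v = 0" and e: "u + s *s x = v + t *s x"
      have "v = (u + s *s x) - t *s x" unfolding e by simp
      then have v': "v = u + (s - t) *s x" by (simp add: vec.scale_left_diff_distrib)
      then have "(s - t) * polar_form Q u x = 0"
        using u v x by (simp only: quadratic_form_add quadratic_form_scale[OF Q]
            polar_form_bilinear[OF Q]) simp
      then have "s = t" using u by (simp add: mem_perp_singleton polar_form_commute)
      with v' show "s = t \<and> u = v" by simp
    qed
    show "?f ` (UNIV \<times> ?S) = U - perp Q {x}"
    proof (intro set_eqI iffI)
      fix z assume "z \<in> ?f ` (UNIV \<times> ?S)"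
      then show "z \<in> U - perp Q {x}"
        using U x px by (auto simp: mem_perp_singleton polar_form_bilinear[OF Q]
            intro!: vec.subspace_add vec.subspace_scale)
    next
      fix z assume z: "z \<in> U - perp Q {x}"
      define t where "t = Q z / polar_form Q x z"
      have nz: "polar_form Q x z \<noteq> 0" using z by (simp add: mem_perp_singleton)
      have "Q (z + (- t) *s x) = Q z + (- t) * polar_form Q z x"
        using x by (simp only: quadratic_form_add quadratic_form_scale[OF Q]
            polar_form_bilinear[OF Q]) simp
      also have "\<dots> = 0" using nz by (simp add: t_def polar_form_commute[of Q z])
      finally have "Q (z + (- t) *s x) = 0" .
      moreover have "z + (- t) *s x \<in> U"
        using z U x by (intro vec.subspace_add vec.subspace_scale) auto
      moreover have "polar_form Q x (z + (- t) *s x) \<noteq> 0"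
        using nz px by (simp only: polar_form_bilinear[OF Q]) simp
      ultimately show "z \<in> ?f ` (UNIV \<times> ?S)"
        by (intro image_eqI[of _ _ "(t, z + (- t) *s x)"]) (auto simp: mem_perp_singleton)
    qed
  qed
  then have "card (UNIV \<times> ?S :: ('a \<times> _) set) = card (U - perp Q {x})" by (rule bij_betw_same_card)
  then show ?thesis by (simp only: card_cartesian_product)
qed

text \<open>Cutting with the perp of a singular vector outside the radical lowers the rank by two, and off
  this hyperplane exactly one vector on every parallel to the singular direction is singular.\<close>

theorem card_singular_vectors_odd_rank:
  fixes U :: "('a::{field,finite} ^ 'n) set"
  assumes Q: "quadratic_form Q" and two: "(2::'a) \<noteq> 0" and U: "vec.subspace U"
    and odd: "odd (vec.dim U + vec.dim (form_radical Q U))"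
  shows "CARD('a) * card {x \<in> U. Q x = 0} = CARD('a) ^ vec.dim U"
  using U odd
proof (induction "vec.dim U" arbitrary: U rule: less_induct)
  case less
  note U = less.prems(1)
  show ?case
  proof (cases "\<exists>x\<in>U. Q x = 0 \<and> x \<notin> form_radical Q U")
    case False
    \<comment> \<open>In this case the rank is 1 and the singular vectors are exactly those of the
      radical, a hyperplane of \<open>U\<close>.\<close>
    then have d: "vec.dim U = vec.dim (form_radical Q U) + 1"
      using less.prems by (intro dim_eq_radical_plus_one[OF Q two]) auto
    have "{x \<in> U. Q x = 0} = form_radical Q U"
      using False nonsingular_not_in_radical[OF Q two, of _ U] by (auto simp: form_radical_def)
    then show ?thesis
      using card_subspace[OF subspace_radical[OF Q U]] by (simp add: d)
  next
    case True
    then obtain x where x: "x \<in> U" "Q x = 0" "x \<notin> form_radical Q U" by blast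
    let ?H = "U \<inter> perp Q {x}"
    have H: "vec.subspace ?H" using U Q by (intro vec.subspace_inter subspace_perp)
    have d: "vec.dim ?H + 1 = vec.dim U" by (rule dim_inter_perp_nonradical[OF Q U x(1,3)])
    have r: "vec.dim (form_radical Q ?H) = vec.dim (form_radical Q U) + 1"
      by (rule dim_radical_inter_perp_singular[OF Q two U x(1,3,2)])
    have "odd (vec.dim ?H + vec.dim (form_radical Q ?H))"
      using less.prems(2) by (simp add: r flip: d)
    then have IH: "CARD('a) * card {u \<in> ?H. Q u = 0} = CARD('a) ^ vec.dim ?H"
      using less.hyps[of ?H] d H by simp
    have "{u \<in> U. Q u = 0} = {u \<in> ?H. Q u = 0} \<union> {u \<in> U - perp Q {x}. Q u = 0}" by auto
    then have "card {u \<in> U. Q u = 0} = card {u \<in> ?H. Q u = 0} + card {u \<in> U - perp Q {x}. Q u = 0}"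
      by (simp only:) (intro card_Un_disjoint; auto)
    \<comment> \<open>Inside the hyperplane by induction, and outside it by the count along
      parallels, the singular vectors are the fraction 1/q of all vectors.\<close>
    then have "CARD('a) * card {u \<in> U. Q u = 0} = card ?H + card (U - perp Q {x})"
      using card_singular_vectors_step[OF Q U x(1,2)] IH card_subspace[OF H]
      by (simp only: distrib_left)
    also have "\<dots> = card U"
      using card_Int_Diff[of U "perp Q {x}"] by simp
    finally show ?thesis using card_subspace[OF U] by simp
  qed
qed

section \<open>Points and lines\<close>

lemma field_embedding_add: "field_embedding h \<Longrightarrow> h (x + y) = h x + h y"
  by (simp add: field_embedding_def)

lemma field_embedding_mult: "field_embedding h \<Longrightarrow> h (x * y) = h x * h y"
  by (simp add: field_embedding_def)

lemma field_embedding_diff: "field_embedding h \<Longrightarrow> h (x - y) = h x - h y"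
  using field_embedding_add[of h "x - y" y] by simp

lemma field_embedding_eq_iff: "field_embedding h \<Longrightarrow> h x = h y \<longleftrightarrow> x = y"
  using field_embedding_eq_zero[of h "x - y"] by (simp add: field_embedding_diff)

lemma field_embedding_divide: "field_embedding h \<Longrightarrow> h (x / y) = h x / h y"
proof (cases "y = 0")
  case False
  assume h: "field_embedding h"
  have "h (x / y) * h y = h x" using False by (simp flip: field_embedding_mult[OF h])
  then show ?thesis using False field_embedding_eq_zero[OF h, of y] by (simp add: field_simps)
qed (simp add: field_embedding_zero)

text \<open>Any \<open>v\<close> outside the image of \<open>h\<close> is independent of 1 over that
  image, and counting makes the two a basis. Completing the square in the quadratic equation of
  \<open>v\<close> then produces \<open>om\<close>.\<close>

lemma quadratic_extension_basis:
  fixes h :: "'a::{field,finite} \<Rightarrow> 'b::{field,finite}"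
  assumes h: "field_embedding h" and two: "(2::'a) \<noteq> 0" and card: "CARD('b) = CARD('a)\<^sup>2"
  obtains om s where "om\<^sup>2 = h s" "\<And>x. x\<^sup>2 \<noteq> s" "bij (\<lambda>(x, y). h x + om * h y)"
proof -
  have bij: "bij (\<lambda>(x, y). h x + v * h y)" if v: "v \<notin> range h" for v
  proof -
    have y: "y = y'" if e: "h x + v * h y = h x' + v * h y'" for x y x' y'
    proof (rule ccontr)
      assume ne: "y \<noteq> y'"
      have "v * h (y - y') = h (x' - x)"
        using e by (simp add: field_embedding_diff[OF h] algebra_simps)
      then have "v = h ((x' - x) / (y - y'))"
        using ne field_embedding_eq_zero[OF h, of "y - y'"]
        by (simp add: field_embedding_divide[OF h] nonzero_eq_divide_eq)
      with v show False by blast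
    qed
    then have inj: "inj (\<lambda>(x, y). h x + v * h y)"
    proof (intro injI, clarify)
      fix x y x' y' assume e: "h x + v * h y = h x' + v * h y'"
      from y[OF e] have "y = y'" .
      with e show "x = x' \<and> y = y'" by (simp add: field_embedding_eq_iff[OF h])
    qed
    have "card (range (\<lambda>(x, y). h x + v * h y)) = CARD('b)"
      using card_image[OF inj] by (simp add: card power2_eq_square)
    then have "range (\<lambda>(x, y). h x + v * h y) = UNIV" by (intro card_subset_eq) auto
    with inj show ?thesis by (simp add: bij_def)
  qed
  have "card (range h) \<le> CARD('a)" by (rule card_image_le) simp
  also have "\<dots> < CARD('b)" using card_field_ge_2[where 'a='a] by (simp add: card power2_eq_square)
  finally have "range h \<noteq> UNIV" by (metis less_irrefl)
  then obtain v where v: "v \<notin> range h" by auto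
  obtain \<alpha> \<beta> where ab: "v\<^sup>2 = h \<alpha> + v * h \<beta>"
    using bij_is_surj[OF bij[OF v]] by (metis (mono_tags, lifting) surjD case_prod_conv surj_pair)
  \<comment> \<open>Shifting by half the linear coefficient removes the linear term, so the square
    of \<open>om\<close> falls into the image of \<open>h\<close>.\<close>
  define om where "om = v - h (\<beta> / 2)"
  have "v = h (x + \<beta> / 2)" if "om = h x" for x
    using that by (simp add: om_def field_embedding_add[OF h] diff_eq_eq)
  then have om: "om \<notin> range h" using v by blast
  have "2 * h (\<beta> / 2) = h \<beta>"
    using two field_embedding_mult[OF h, of 2 "\<beta> / 2"] by (simp add: field_embedding_two[OF h])
  then have "om\<^sup>2 = h \<alpha> + h (\<beta> / 2) * h (\<beta> / 2)"
    using ab by (simp add: om_def power2_eq_square algebra_simps)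
  then have sq: "om\<^sup>2 = h (\<alpha> + \<beta> / 2 * (\<beta> / 2))"
    by (simp only: field_embedding_add[OF h] field_embedding_mult[OF h])
  \<comment> \<open>A square root in the small field would force \<open>om\<close> to be plus or
    minus its image, hence in the range of \<open>h\<close>.\<close>
  have "x\<^sup>2 \<noteq> \<alpha> + \<beta> / 2 * (\<beta> / 2)" for x
  proof
    assume "x\<^sup>2 = \<alpha> + \<beta> / 2 * (\<beta> / 2)"
    then have "om\<^sup>2 = (h x)\<^sup>2"
      unfolding sq by (metis field_embedding_mult[OF h] power2_eq_square)
    then have "om = h x \<or> om = h (0 - x)"
      by (simp only: field_embedding_diff[OF h] field_embedding_zero[OF h] power2_eq_iff) simp
    with om show False by blast
  qed
  then show ?thesis using sq bij[OF om] by (intro that)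
qed

lemma ext_vec_add: "field_embedding h \<Longrightarrow> ext_vec h (x + y) = ext_vec h x + ext_vec h y"
  by (simp add: ext_vec_def vec_eq_iff field_embedding_add)

lemma ext_vec_zero: "field_embedding h \<Longrightarrow> ext_vec h 0 = 0"
  by (simp add: ext_vec_def vec_eq_iff field_embedding_zero)

section \<open>Lines and points as spans\<close>

lemma proj_lines_span:
  assumes "x \<noteq> 0" "y \<notin> vec.span {x}"
  shows "vec.span {x, y} \<in> proj_lines"
  using assms by (simp add: proj_lines_def vec.dim_insert insert_commute[of x y])

lemma proj_line_eq_span:
  fixes l :: "('a::field ^ 'n) set"
  assumes l: "l \<in> proj_lines" and "x \<in> l" "y \<in> l" "x \<noteq> 0" "y \<notin> vec.span {x}"
  shows "l = vec.span {x, y}"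
proof -
  have "vec.span {x, y} \<subseteq> l" using assms by (intro vec.span_minimal) (auto simp: proj_lines_def)
  moreover have "vec.dim l \<le> vec.dim (vec.span {x, y})"
    using l proj_lines_span[OF assms(4,5)] by (simp add: proj_lines_def)
  ultimately show ?thesis
    using l by (metis (no_types, lifting) mem_Collect_eq proj_lines_def vec.subspace_dim_equal vec.subspace_span)
qed

lemma proj_line_obtain_basis:
  assumes "l \<in> proj_lines" "x \<in> l" "x \<noteq> 0"
  obtains y where "y \<in> l" "y \<notin> vec.span {x}" "l = vec.span {x, y}"
proof -
  have "\<not> l \<subseteq> vec.span {x}"
  proof
    assume "l \<subseteq> vec.span {x}"
    then have "vec.dim l \<le> 1" using vec.dim_le_card[of l "{x}"] by simp
    with assms show False by (simp add: proj_lines_def)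
  qed
  then show ?thesis using that proj_line_eq_span[OF assms(1,2) _ assms(3)] by blast
qed

lemma dependent_pair_obtain:
  assumes "\<not> (x \<noteq> 0 \<and> y \<notin> vec.span {x})" "x \<noteq> 0 \<or> y \<noteq> 0"
  obtains z where "z \<noteq> 0" "x \<in> vec.span {z}" "y \<in> vec.span {z}"
proof (cases "x = 0")
  case True
  then show ?thesis using assms that[of y] by (simp add: vec.span_zero vec.span_base)
next
  case False
  then show ?thesis using assms that[of x] by (simp add: vec.span_base)
qed

lemma span_singleton_in_proj_points: "x \<noteq> 0 \<Longrightarrow> vec.span {x} \<in> proj_points"
  by (auto simp: proj_points_iff)

lemma card_points_line_inter_perp:
  fixes Q :: "'a::{field,finite} ^ 'n \<Rightarrow> 'a"
  assumes Q: "quadratic_form Q" and l: "l \<in> proj_lines"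
  shows "card {P \<in> proj_points. P \<subseteq> l \<inter> perp Q {w}} =
    (if l \<subseteq> perp Q {w} then CARD('a) + 1 else 1)"
proof -
  have sl: "vec.subspace l" "vec.dim l = 2" using l by (auto simp: proj_lines_def)
  have s: "vec.subspace (l \<inter> perp Q {w})"
    using sl subspace_perp[OF Q] by (intro vec.subspace_inter) auto
  show ?thesis
  proof (cases "l \<subseteq> perp Q {w}")
    case True
    then have "l \<inter> perp Q {w} = l" by blast
    with True show ?thesis using card_points_subspace(2)[OF sl] by simp
  next
    case False
    then obtain u where "u \<in> l" "polar_form Q w u \<noteq> 0" by (meson mem_perp_singleton subsetI)
    from dim_inter_perp[OF Q sl(1) this] have "vec.dim (l \<inter> perp Q {w}) = 1" using sl by simp
    with False show ?thesis using card_points_subspace(1)[OF s] by simp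
  qed
qed

section \<open>Points and lines of the quadric, and covers\<close>

lemma span_singleton_in_quadric_points:
  assumes "quadratic_form Q" "x \<noteq> 0"
  shows "vec.span {x} \<in> quadric_points Q \<longleftrightarrow> Q x = 0"
  using assms span_singleton_in_proj_points[OF assms(2)]
  by (auto simp: quadric_points_def vec.span_singleton quadratic_form_scale dest: spec[of _ 1])

lemma quadric_lines_iff:
  assumes Q: "quadratic_form Q"
  shows "l \<in> quadric_lines Q \<longleftrightarrow> l \<in> proj_lines \<and> (\<forall>x\<in>l. Q x = 0)"
proof
  assume l: "l \<in> quadric_lines Q"
  then have pl: "l \<in> proj_lines" by (simp add: quadric_lines_def)
  have "Q x = 0" if x: "x \<in> l" for x
  proof (cases "x = 0")
    case False
    have "vec.span {x} \<subseteq> l" using pl x by (intro vec.span_minimal) (auto simp: proj_lines_def)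
    then have "vec.span {x} \<in> quadric_points Q"
      using l False span_singleton_in_proj_points by (auto simp: quadric_lines_def)
    then show ?thesis using False Q by (simp add: span_singleton_in_quadric_points)
  qed (simp add: quadratic_form_zero[OF Q])
  with pl show "l \<in> proj_lines \<and> (\<forall>x\<in>l. Q x = 0)" by blast
qed (auto simp: quadric_lines_def quadric_points_def)

text \<open>The singular vectors of \<open>U\<close> form a cone of \<open>CARD('a) ^ d\<close>
  vectors, to which the count of points in a cone applies.\<close>

lemma card_quadric_points_odd_rank:
  fixes Q :: "'a::{field,finite} ^ 'n \<Rightarrow> 'a"
  assumes Q: "quadratic_form Q" and two: "(2::'a) \<noteq> 0" and U: "vec.subspace U"
    and odd: "odd (vec.dim U + vec.dim (form_radical Q U))" and d: "vec.dim U = Suc d"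
  shows "card {P \<in> quadric_points Q. P \<subseteq> U} * (CARD('a) - 1) + 1 = CARD('a) ^ d"
proof -
  let ?Z = "{x \<in> U. Q x = 0}"
  have "{P \<in> quadric_points Q. P \<subseteq> U} = {P \<in> proj_points. P \<subseteq> ?Z}"
    by (auto simp: quadric_points_def)
  moreover have "card {P \<in> proj_points. P \<subseteq> ?Z} * (CARD('a) - 1) + 1 = card ?Z"
  proof (rule card_points_cone)
    show "c *s x \<in> ?Z" if "x \<in> ?Z" for c x
      using that U by (simp add: vec.subspace_scale quadratic_form_scale[OF Q])
    show "?Z \<noteq> {}" using vec.subspace_0[OF U] quadratic_form_zero[OF Q] by blast
  qed
  moreover have "CARD('a) * card ?Z = CARD('a) * CARD('a) ^ d"
    using card_singular_vectors_odd_rank[OF Q two U odd] by (simp add: d)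
  then have "card ?Z = CARD('a) ^ d" by simp
  ultimately show ?thesis by simp
qed

lemma m_cover_incidences:
  fixes Q :: "'a::{field,finite} ^ 'n \<Rightarrow> 'a"
  assumes L: "m_cover Q m L" and N: "N \<subseteq> quadric_points Q"
  shows "(\<Sum>l\<in>L. card {p \<in> N. p \<subseteq> l}) = m * card N"
  using L N by (intro sum_multicount) (auto simp: m_cover_def)

lemma sum_if_const_nat:
  fixes c d :: nat
  assumes "finite L"
  shows "(\<Sum>l\<in>L. if P l then c + d else d) = c * card {l \<in> L. P l} + d * card L"
proof -
  have "(\<Sum>l\<in>L. if P l then c + d else d) = (\<Sum>l\<in>L. (if P l then c else 0) + d)"
    by (intro sum.cong) auto
  also have "\<dots> = c * card {l \<in> L. P l} + d * card L"
    using assms by (simp add: sum.distrib sum.If_cases Int_def)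
  finally show ?thesis .
qed

section \<open>The geometry over the quadratic extension\<close>

text \<open>Here \<open>om\<close> is a square root of the nonsquare \<open>s\<close>, and elements
  of the large field have unique coordinates with respect to 1 and \<open>om\<close>. The data are
  those produced by \<open>quadratic_extension_basis\<close>.\<close>

locale quadratic_extension =
  fixes h :: "'a::{field,finite} \<Rightarrow> 'b::{field,finite}" and om :: 'b and s :: 'a
    and Q :: "'a ^ 'n::finite \<Rightarrow> 'a"
  assumes h: "field_embedding h"
    and om_sq: "om\<^sup>2 = h s"
    and nonsquare: "\<And>x. x\<^sup>2 \<noteq> s"
    and basis: "bij (\<lambda>(x, y). h x + om * h y)"
    and two: "(2::'a) \<noteq> 0"
    and Q: "quadratic_form Q"
begin

abbreviation E :: "'b ^ 'n \<Rightarrow> 'b" where "E \<equiv> ext_form h Q"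

text \<open>The arguments act as real and imaginary parts; every vector over the large field has
  this form in exactly one way.\<close>

definition emb :: "'a ^ 'n \<Rightarrow> 'a ^ 'n \<Rightarrow> 'b ^ 'n" where
  "emb x y = ext_vec h x + om *s ext_vec h y"

lemma E: "quadratic_form E"
  by (rule quadratic_form_ext_form)

lemma basis_eq_iff: "h x + om * h y = h x' + om * h y' \<longleftrightarrow> x = x' \<and> y = y'"
  using injD[OF bij_is_inj[OF basis], of "(x, y)" "(x', y')"] by auto

lemma basis_eq_zero_iff: "h x + om * h y = 0 \<longleftrightarrow> x = 0 \<and> y = 0"
  using basis_eq_iff[of x y 0 0] by (simp add: field_embedding_zero[OF h])

lemma obtain_basis: obtains x y where "z = h x + om * h y"
proof -
  obtain p where "z = (\<lambda>(x, y). h x + om * h y) p" using bij_is_surj[OF basis] by (rule surjE)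
  then show ?thesis using that by (cases p) simp
qed

lemma card_large: "CARD('b) = CARD('a)\<^sup>2"
  using bij_betw_same_card[OF basis] by (simp add: power2_eq_square)

lemma emb_eq_iff: "emb x y = emb x' y' \<longleftrightarrow> x = x' \<and> y = y'"
  by (auto simp: emb_def ext_vec_def vec_eq_iff basis_eq_iff)

lemma emb_zero: "emb 0 0 = 0"
  by (simp add: emb_def ext_vec_zero[OF h])

lemma emb_eq_zero_iff: "emb x y = 0 \<longleftrightarrow> x = 0 \<and> y = 0"
  using emb_eq_iff[of x y 0 0] by (simp add: emb_zero)

lemma obtain_emb: obtains x y where "w = emb x y"
proof -
  have "\<exists>x y. w $ i = h x + om * h y" for i by (rule obtain_basis[of "w $ i"]) blast
  then obtain x y where "\<And>i. w $ i = h (x i) + om * h (y i)" by metis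
  then have "w = emb (\<chi> i. x i) (\<chi> i. y i)" by (simp add: emb_def ext_vec_def vec_eq_iff)
  then show ?thesis by (rule that)
qed

lemma emb_add: "emb x y + emb x' y' = emb (x + x') (y + y')"
  by (simp add: emb_def ext_vec_add[OF h] vec.scale_right_distrib)

lemma emb_scale: "(h u + om * h v) *s emb x y = emb (u *s x + (s * v) *s y) (v *s x + u *s y)"
proof -
  have om2: "om * (om * c) = h s * c" for c
    using om_sq by (simp add: power2_eq_square flip: mult.assoc)
  show ?thesis
    by (simp add: emb_def ext_vec_def vec_eq_iff field_embedding_add[OF h] field_embedding_mult[OF h]
        om2 algebra_simps)
qed

lemma polar_E_ext_vec: "polar_form E (ext_vec h x) (ext_vec h y) = h (polar_form Q x y)"
  by (simp add: polar_form_def ext_form_ext_vec[OF Q h two] field_embedding_diff[OF h]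
      flip: ext_vec_add[OF h])

lemma polar_E_emb: "polar_form E (emb a b) (emb x y) =
    h (polar_form Q a x + s * polar_form Q b y) + om * h (polar_form Q a y + polar_form Q b x)"
proof -
  have om2: "om * (om * c) = h s * c" for c
    using om_sq by (simp add: power2_eq_square flip: mult.assoc)
  show ?thesis
    by (simp add: emb_def polar_form_bilinear[OF E] polar_E_ext_vec
        field_embedding_add[OF h] field_embedding_mult[OF h] om2 algebra_simps)
qed

lemma E_emb: "E (emb a b) = h (Q a + s * Q b) + om * h (polar_form Q a b)"
  by (simp add: emb_def quadratic_form_add[of E] quadratic_form_scale[OF E] polar_form_bilinear[OF E]
      ext_form_ext_vec[OF Q h two] polar_E_ext_vec om_sq
      field_embedding_add[OF h] field_embedding_mult[OF h])

text \<open>The coefficients of 1 and \<open>om\<close> vanish separately, so one equation over the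
  large field becomes two over the small one.\<close>

lemma E_emb_eq_zero_iff: "E (emb a b) = 0 \<longleftrightarrow> Q a + s * Q b = 0 \<and> polar_form Q a b = 0"
  by (simp only: E_emb basis_eq_zero_iff)

lemma emb_mem_perp_iff:
  "emb x y \<in> perp E {emb a b} \<longleftrightarrow>
    polar_form Q a x + s * polar_form Q b y = 0 \<and> polar_form Q a y + polar_form Q b x = 0"
  by (simp only: mem_perp_singleton polar_E_emb basis_eq_zero_iff)

text \<open>By \<open>emb_scale\<close>, a large scalar only recombines the real and imaginary parts
  inside \<open>l\<close>. The subspace \<open>l\<close> is arbitrary, since small points are
  extended in the same way as lines.\<close>

lemma ext_line_eq:
  assumes l: "vec.subspace l"
  shows "ext_line h l = {emb x y |x y. x \<in> l \<and> y \<in> l}" (is "_ = ?R")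
proof
  have "vec.subspace ?R"
  proof (rule vec.subspaceI)
    show "0 \<in> ?R" using emb_zero vec.subspace_0[OF l] by (intro CollectI exI[of _ 0]) simp
    show "v + w \<in> ?R" if "v \<in> ?R" "w \<in> ?R" for v w
      using that emb_add vec.subspace_add[OF l] by blast
    show "c *s v \<in> ?R" if v: "v \<in> ?R" for c v
    proof -
      obtain x y where "v = emb x y" "x \<in> l" "y \<in> l" using v by blast
      moreover obtain u u' where "c = h u + om * h u'" by (rule obtain_basis)
      ultimately have "c *s v = emb (u *s x + (s * u') *s y) (u' *s x + u *s y)"
          "u *s x + (s * u') *s y \<in> l" "u' *s x + u *s y \<in> l"
        using l by (simp_all only: emb_scale vec.subspace_add vec.subspace_scale)
      then show ?thesis by blast
    qed
  qed
  moreover have "ext_vec h x = emb x 0" for x by (simp add: emb_def ext_vec_zero[OF h])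
  then have "ext_vec h ` l \<subseteq> ?R" using vec.subspace_0[OF l] by blast
  ultimately show "ext_line h l \<subseteq> ?R" unfolding ext_line_def by (intro vec.span_minimal)
  show "?R \<subseteq> ext_line h l"
    unfolding ext_line_def emb_def by (auto intro!: vec.span_add vec.span_scale intro: vec.span_base)
qed

lemma emb_mem_ext_line: "vec.subspace l \<Longrightarrow> emb x y \<in> ext_line h l \<longleftrightarrow> x \<in> l \<and> y \<in> l"
  by (auto simp: ext_line_eq emb_eq_iff)

lemma subspace_ext_line: "vec.subspace (ext_line h l)"
  by (simp add: ext_line_def)

lemma ext_line_subset_iff:
  fixes k l :: "('a ^ 'n) set"
  assumes k: "vec.subspace k" and l: "vec.subspace l"
  shows "ext_line h k \<subseteq> ext_line h l \<longleftrightarrow> k \<subseteq> l"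
proof
  assume e: "ext_line h k \<subseteq> ext_line h l"
  show "k \<subseteq> l"
  proof
    fix x assume "x \<in> k"
    then have "emb x x \<in> ext_line h k" by (simp add: emb_mem_ext_line[OF k])
    then show "x \<in> l" using e emb_mem_ext_line[OF l] by blast
  qed
qed (auto simp: ext_line_eq[OF k] ext_line_eq[OF l])

text \<open>The extension has as many vectors as there are pairs from \<open>l\<close>; as the large
  field has q squared elements, comparing powers gives the dimension.\<close>

lemma dim_ext_line:
  fixes l :: "('a ^ 'n) set"
  assumes l: "vec.subspace l"
  shows "vec.dim (ext_line h l) = vec.dim l"
proof -
  have "ext_line h l = (\<lambda>(x, y). emb x y) ` (l \<times> l)" by (auto simp: ext_line_eq[OF l])
  moreover have "inj_on (\<lambda>(x, y). emb x y) (l \<times> l)" by (auto simp: inj_on_def emb_eq_iff)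
  ultimately have "card (ext_line h l) = card (l \<times> l)" by (simp add: card_image)
  also have "\<dots> = CARD('b) ^ vec.dim l"
    by (simp add: card_cartesian_product card_subspace[OF l] card_large power2_eq_square
        power_mult_distrib)
  finally have "CARD('b) ^ vec.dim (ext_line h l) = CARD('b) ^ vec.dim l"
    using card_subspace[OF subspace_ext_line] by metis
  then show ?thesis using card_field_ge_2[where 'a='b] by simp
qed

lemma ext_line_in_proj_points:
  fixes p :: "('a ^ 'n) set"
  shows "p \<in> proj_points \<Longrightarrow> ext_line h p \<in> proj_points"
  by (simp add: proj_points_def dim_ext_line subspace_ext_line)

lemma ext_line_in_proj_lines:
  fixes l :: "('a ^ 'n) set"
  shows "l \<in> proj_lines \<Longrightarrow> ext_line h l \<in> proj_lines"
  by (simp add: proj_lines_def dim_ext_line subspace_ext_line)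

lemma ext_line_subset_perp_iff:
  assumes l: "vec.subspace l"
  shows "ext_line h l \<subseteq> perp E {emb a b} \<longleftrightarrow> l \<subseteq> perp Q {a, b}"
proof
  assume e: "ext_line h l \<subseteq> perp E {emb a b}"
  show "l \<subseteq> perp Q {a, b}"
  proof
    fix x assume "x \<in> l"
    then have "emb x 0 \<in> perp E {emb a b}"
      using e emb_mem_ext_line[OF l] vec.subspace_0[OF l] by blast
    then show "x \<in> perp Q {a, b}"
      unfolding emb_mem_perp_iff by (simp add: perp_def polar_form_zero[OF Q])
  qed
next
  assume "l \<subseteq> perp Q {a, b}"
  then have "polar_form Q a x = 0" "polar_form Q b x = 0" if "x \<in> l" for x
    using that by (auto simp: perp_def)
  then show "ext_line h l \<subseteq> perp E {emb a b}"
    by (auto simp: ext_line_eq[OF l] emb_mem_perp_iff)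
qed

text \<open>A totally singular subspace also annihilates the polar form, which kills both
  coordinates of \<open>E_emb\<close>.\<close>

lemma ext_line_singular_iff:
  assumes l: "vec.subspace l"
  shows "(\<forall>w\<in>ext_line h l. E w = 0) \<longleftrightarrow> (\<forall>x\<in>l. Q x = 0)"
proof
  assume e: "\<forall>w\<in>ext_line h l. E w = 0"
  show "\<forall>x\<in>l. Q x = 0"
  proof
    fix x assume "x \<in> l"
    then have "E (emb x 0) = 0"
      using e emb_mem_ext_line[OF l] vec.subspace_0[OF l] by blast
    then show "Q x = 0" by (simp add: E_emb_eq_zero_iff quadratic_form_zero[OF Q])
  qed
next
  assume q: "\<forall>x\<in>l. Q x = 0"
  have "polar_form Q x y = 0" if "x \<in> l" "y \<in> l" for x y
    using q that vec.subspace_add[OF l] by (simp add: polar_form_def)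
  with q show "\<forall>w\<in>ext_line h l. E w = 0"
    by (auto simp: ext_line_eq[OF l] E_emb_eq_zero_iff)
qed

lemma ext_line_in_quadric_points:
  assumes "p \<in> proj_points"
  shows "ext_line h p \<in> quadric_points E \<longleftrightarrow> p \<in> quadric_points Q"
  using assms ext_line_in_proj_points ext_line_singular_iff[of p]
  by (simp add: quadric_points_def) (simp add: proj_points_def)

text \<open>This separates two types of points: unless the real and imaginary parts are independent,
  the point is the extension of a small one.\<close>

lemma emb_dependent:
  assumes "\<not> (x \<noteq> 0 \<and> y \<notin> vec.span {x})" "x \<noteq> 0 \<or> y \<noteq> 0"
  obtains p where "p \<in> proj_points" "vec.span {emb x y} = ext_line h p"
proof -
  obtain z where z: "z \<noteq> 0" "x \<in> vec.span {z}" "y \<in> vec.span {z}"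
    using dependent_pair_obtain[OF assms] by blast
  have "emb x y \<in> ext_line h (vec.span {z})" using z by (simp add: emb_mem_ext_line)
  moreover have "emb x y \<noteq> 0" using assms by (simp add: emb_eq_zero_iff)
  moreover have p: "vec.span {z} \<in> proj_points" by (rule span_singleton_in_proj_points[OF z(1)])
  ultimately show ?thesis using that proj_point_eq_span ext_line_in_proj_points by metis
qed

lemma span_emb_subset_ext_line_iff:
  assumes "vec.subspace l"
  shows "vec.span {emb x y} \<subseteq> ext_line h l \<longleftrightarrow> x \<in> l \<and> y \<in> l"
  using emb_mem_ext_line[OF assms] span_singleton_subset_iff vec.subspace_scale[OF subspace_ext_line]
  by metis

text \<open>Double counting of the flags of a line of \<open>L\<close> and a point of its extension: a point of the small
  geometry lies on \<open>m\<close> extended lines, any other point on at most one.\<close>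

lemma card_ext_points_incidences:
  assumes L: "m_cover Q m L" and U: "U = perp Q {a, b}"
  shows "card {R \<in> ext_points h Q L. R \<subseteq> perp E {emb a b}} + m * card {p \<in> quadric_points Q. p \<subseteq> U} =
    CARD('b) * card {l \<in> L. l \<subseteq> U} + card L + card {p \<in> quadric_points Q. p \<subseteq> U}"
proof -
  let ?w = "emb a b"
  let ?T = "{R \<in> ext_points h Q L. R \<subseteq> perp E {?w}}"
  let ?N = "{p \<in> quadric_points Q. p \<subseteq> U}"
  let ?c = "\<lambda>R. card {l \<in> L. R \<subseteq> ext_line h l}"
  have m: "m > 0" and LQ: "L \<subseteq> quadric_lines Q"
    and cm: "\<And>p. p \<in> quadric_points Q \<Longrightarrow> card {l \<in> L. p \<subseteq> l} = m"
    using L by (auto simp: m_cover_def)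
  have Ll: "l \<in> proj_lines" "\<forall>x\<in>l. Q x = 0" "vec.subspace l" if "l \<in> L" for l
    using that LQ quadric_lines_iff[OF Q] by (auto simp: proj_lines_def)
  have sub: "vec.subspace p" if "p \<in> quadric_points Q" for p
    using that by (simp add: quadric_points_def proj_points_def)
  \<comment> \<open>Every point on an extended line of \<open>L\<close> belongs to the point set, so
    only the intersection of that line with the hyperplane matters.\<close>
  have onl: "card {R \<in> ?T. R \<subseteq> ext_line h l} = (if l \<subseteq> U then CARD('b) + 1 else 1)" if l: "l \<in> L" for l
  proof -
    have "{R \<in> ?T. R \<subseteq> ext_line h l} = {R \<in> proj_points. R \<subseteq> ext_line h l \<inter> perp E {?w}}"
      using l Ll[OF l] ext_line_singular_iff[of l] by (auto simp: ext_points_def quadric_points_def)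
    then show ?thesis
      using card_points_line_inter_perp[OF E ext_line_in_proj_lines[OF Ll(1)[OF l]], of ?w]
      by (simp add: ext_line_subset_perp_iff[OF Ll(3)[OF l]] U)
  qed
  have inj: "inj_on (ext_line h) ?N"
  proof (rule inj_onI)
    fix p p' assume "p \<in> ?N" "p' \<in> ?N" "ext_line h p = ext_line h p'"
    then show "p = p'"
      using ext_line_subset_iff[of p p'] ext_line_subset_iff[of p' p] sub by blast
  qed
  have NT: "ext_line h ` ?N \<subseteq> ?T"
  proof
    fix R assume "R \<in> ext_line h ` ?N"
    then obtain p where p: "R = ext_line h p" "p \<in> quadric_points Q" "p \<subseteq> U" by blast
    \<comment> \<open>Positivity of \<open>m\<close> puts a line of \<open>L\<close> through each
      small singular point.\<close>
    have "{l \<in> L. p \<subseteq> l} \<noteq> {}" using cm[OF p(2)] m by (metis card.empty less_irrefl)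
    then obtain l where l: "l \<in> L" "p \<subseteq> l" by blast
    have "R \<subseteq> ext_line h l" using p l Ll(3) sub by (simp add: ext_line_subset_iff)
    moreover have "R \<in> quadric_points E"
      using p ext_line_in_quadric_points[of p] by (simp add: quadric_points_def)
    moreover have "R \<subseteq> perp E {?w}" using p sub by (simp add: ext_line_subset_perp_iff U)
    ultimately show "R \<in> ?T" using l by (auto simp: ext_points_def)
  qed
  have real: "?c R = m" if R: "R \<in> ext_line h ` ?N" for R
  proof -
    obtain p where p: "R = ext_line h p" "p \<in> quadric_points Q" using R by blast
    have "{l \<in> L. R \<subseteq> ext_line h l} = {l \<in> L. p \<subseteq> l}"
      unfolding p(1) using p(2) Ll(3) sub
      by (intro Collect_cong conj_cong refl ext_line_subset_iff) auto
    then show ?thesis using cm p by simp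
  qed
  have imag: "?c R = 1" if R: "R \<in> ?T - ext_line h ` ?N" for R
  proof -
    have RE: "R \<in> quadric_points E" "R \<in> proj_points" using R by (auto simp: ext_points_def quadric_points_def)
    then obtain w where w: "R = vec.span {w}" "w \<noteq> 0" by (auto simp: proj_points_iff)
    obtain x y where xy: "w = emb x y" by (rule obtain_emb)
    have nz: "x \<noteq> 0 \<or> y \<noteq> 0" using w xy by (auto simp: emb_zero)
    have ind: "x \<noteq> 0 \<and> y \<notin> vec.span {x}"
    proof (rule ccontr)
      assume "\<not> (x \<noteq> 0 \<and> y \<notin> vec.span {x})"
      then obtain p where p: "p \<in> proj_points" "R = ext_line h p"
        using emb_dependent[OF _ nz] w xy by metis
      then have "p \<in> quadric_points Q" using RE ext_line_in_quadric_points by blast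
      moreover have "p \<subseteq> U"
        using R p ext_line_subset_perp_iff[of p a b] by (auto simp: U proj_points_def)
      ultimately show False using R p by blast
    qed
    obtain l where l: "l \<in> L" "R \<subseteq> ext_line h l" using R by (auto simp: ext_points_def)
    \<comment> \<open>Such a line contains the independent vectors \<open>x\<close> and
      \<open>y\<close>, so it is determined by the point.\<close>
    have "k = vec.span {x, y}" if "k \<in> L" "R \<subseteq> ext_line h k" for k
      using that ind Ll[OF that(1)] proj_line_eq_span[of k x y]
      by (simp add: w(1) xy span_emb_subset_ext_line_iff)
    then have "{k \<in> L. R \<subseteq> ext_line h k} = {l}" using l by auto
    then show ?thesis by simp
  qed
  have "(\<Sum>l\<in>L. card {R \<in> ?T. R \<subseteq> ext_line h l}) = sum ?c ?T"
    by (rule sum_multicount_gen) simp_all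
  moreover have "(\<Sum>l\<in>L. card {R \<in> ?T. R \<subseteq> ext_line h l}) =
      (\<Sum>l\<in>L. if l \<subseteq> U then CARD('b) + 1 else 1)"
    by (rule sum.cong[OF refl onl])
  moreover have "\<dots> = CARD('b) * card {l \<in> L. l \<subseteq> U} + 1 * card L"
    by (rule sum_if_const_nat) simp
  moreover have "sum ?c ?T = sum ?c (?T - ext_line h ` ?N) + sum ?c (ext_line h ` ?N)"
    by (rule sum.subset_diff[OF NT]) simp
  moreover have "sum ?c (ext_line h ` ?N) = m * card ?N"
    using real card_image[OF inj] by simp
  moreover have "sum ?c (?T - ext_line h ` ?N) = card (?T - ext_line h ` ?N)"
    using imag by simp
  moreover have "card ?T = card (?T - ext_line h ` ?N) + card ?N"
    using card_image[OF inj] card_Diff_subset[OF _ NT] card_mono[OF _ NT] by simp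
  ultimately show ?thesis by linarith
qed

end

section \<open>Imaginary points and small lines\<close>

context quadratic_extension
begin

text \<open>At \<open>u *s a + v *s b\<close> the form equals
  \<open>Q b * (v\<^sup>2 - s * u\<^sup>2)\<close>. The second factor vanishes only for
  \<open>u = v = 0\<close>, because \<open>s\<close> is a nonsquare; so everything depends on
  whether \<open>Q b\<close> is zero.\<close>

lemma imaginary_line_singular_or_anisotropic:
  assumes "E (emb a b) = 0"
  shows "(\<forall>x\<in>vec.span {a, b}. Q x = 0) \<or>
    (Q a \<noteq> 0 \<and> Q b \<noteq> 0 \<and> polar_form Q a b = 0 \<and> (\<forall>x\<in>vec.span {a, b}. Q x = 0 \<longrightarrow> x = 0))"
proof -
  have e: "Q a = - (s * Q b)" "polar_form Q a b = 0"
    using assms by (simp_all add: E_emb_eq_zero_iff eq_neg_iff_add_eq_0)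
  have form: "\<exists>u v. x = u *s a + v *s b \<and> Q x = Q b * (v\<^sup>2 - s * u\<^sup>2)"
    if xl: "x \<in> vec.span {a, b}" for x
  proof -
    obtain u where "x - u *s a \<in> vec.span {b}" using xl unfolding vec.span_insert[of a] by blast
    then obtain v where "x - u *s a = v *s b" unfolding vec.span_singleton by blast
    then have x: "x = u *s a + v *s b" by (simp add: diff_eq_eq add.commute)
    have "Q x = u\<^sup>2 * Q a + v\<^sup>2 * Q b"
      by (simp add: x quadratic_form_add[of Q] quadratic_form_scale[OF Q] polar_form_bilinear[OF Q] e(2))
    then show ?thesis using x by (auto simp: e(1) algebra_simps)
  qed
  show ?thesis
  proof (cases "Q b = 0")
    case True
    then show ?thesis using form by auto
  next
    case False
    have "s \<noteq> 0" using nonsquare[of 0] by auto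
    then have "Q a \<noteq> 0" using False e by simp
    moreover have "x = 0" if "x \<in> vec.span {a, b}" "Q x = 0" for x
    proof -
      obtain u v where x: "x = u *s a + v *s b" and "Q x = Q b * (v\<^sup>2 - s * u\<^sup>2)"
        using form \<open>x \<in> _\<close> by blast
      then have v: "v\<^sup>2 = s * u\<^sup>2" using False \<open>Q x = 0\<close> by simp
      have "(v / u)\<^sup>2 = s" if "u \<noteq> 0" using v that by (simp add: power_divide)
      then have "u = 0" using nonsquare by blast
      with v x show ?thesis by simp
    qed
    ultimately show ?thesis using False e by blast
  qed
qed

text \<open>The converse direction. On a totally singular line any basis works; on an anisotropic
  one an orthogonal basis is rescaled so that the two values of the form cancel against
  \<open>s\<close>.\<close>

lemma line_obtain_imaginary:
  assumes l: "l \<in> proj_lines"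
    and Ql: "(\<forall>x\<in>l. Q x = 0) \<or> (\<forall>x\<in>l. Q x = 0 \<longrightarrow> x = 0)"
  obtains a b where "a \<noteq> 0" "b \<notin> vec.span {a}" "l = vec.span {a, b}" "E (emb a b) = 0"
proof -
  have sl: "vec.subspace l" using l by (simp add: proj_lines_def)
  have "l \<noteq> {0}" using l by (auto simp: proj_lines_def)
  then obtain b where b: "b \<in> l" "b \<noteq> 0" using vec.subspace_0[OF sl] by blast
  obtain c where c: "c \<in> l" "c \<notin> vec.span {b}" "l = vec.span {b, c}"
    using proj_line_obtain_basis[OF l b] by blast
  show ?thesis
  proof (cases "\<forall>x\<in>l. Q x = 0")
    case True
    then have "\<forall>w\<in>ext_line h l. E w = 0" using ext_line_singular_iff[OF sl] by simp
    then have "E (emb b c) = 0" using b c emb_mem_ext_line[OF sl] by blast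
    then show ?thesis using that b c by blast
  next
    case False
    then have aniso: "x = 0" if "x \<in> l" "Q x = 0" for x using Ql that by blast
    have Qb: "Q b \<noteq> 0" using aniso b by blast
    then have bb: "polar_form Q b b \<noteq> 0" using two by (simp add: polar_form_self[OF Q])
    \<comment> \<open>Gram-Schmidt step: \<open>d\<close> completes \<open>b\<close> to an
      orthogonal basis of \<open>l\<close>.\<close>
    define d where "d = c - (polar_form Q b c / polar_form Q b b) *s b"
    have d: "d \<in> l" "polar_form Q b d = 0"
      using hyperplane_decomposition[OF Q sl b(1) bb c(1)] by (simp_all add: d_def mem_perp_singleton)
    have d0: "d \<notin> vec.span {b}"
    proof
      assume "d \<in> vec.span {b}"
      then have "d + (polar_form Q b c / polar_form Q b b) *s b \<in> vec.span {b}"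
        by (intro vec.span_add vec.span_scale) (auto intro: vec.span_base)
      with c show False by (simp add: d_def)
    qed
    \<comment> \<open>A root \<open>x\<close> would make \<open>d + x *s b\<close> a nonzero
      singular vector of the anisotropic line.\<close>
    have nsq: "x\<^sup>2 \<noteq> - (Q d / Q b)" for x
    proof
      assume x: "x\<^sup>2 = - (Q d / Q b)"
      have "Q (d + x *s b) = Q d + x\<^sup>2 * Q b"
        using d by (simp add: quadratic_form_add[of Q] quadratic_form_scale[OF Q]
            polar_form_bilinear[OF Q] polar_form_commute[of Q d])
      also have "\<dots> = 0" using x Qb by simp
      finally have "d + x *s b = 0"
        using d b sl by (intro aniso vec.subspace_add vec.subspace_scale) auto
      then have "d = (- x) *s b" by (simp add: eq_neg_iff_add_eq_0)
      then show False using d0 unfolding vec.span_singleton by blast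
    qed
    \<comment> \<open>Two nonsquares differ by a square factor; replacing \<open>b\<close> by
      \<open>t *s b\<close> absorbs it.\<close>
    obtain t where t: "- (Q d / Q b) = s * t\<^sup>2"
      by (rule nonsquares_ratio_square[OF two nonsquare nsq])
    have Qd: "Q d \<noteq> 0" using aniso[OF d(1)] d0 by (auto simp: vec.span_zero)
    then have t0: "t \<noteq> 0" using t Qb by auto
    have "- Q d = s * Q (t *s b)"
      using t Qb by (simp add: quadratic_form_scale[OF Q] field_simps)
    then have "Q d + s * Q (t *s b) = 0" by (metis add.right_inverse)
    then have E0: "E (emb d (t *s b)) = 0"
      using d by (simp add: E_emb_eq_zero_iff polar_form_bilinear[OF Q] polar_form_commute[of Q d])
    have d00: "d \<noteq> 0" using d0 by (auto simp: vec.span_zero)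
    have tb: "t *s b \<notin> vec.span {d}"
    proof
      assume "t *s b \<in> vec.span {d}"
      then obtain k where k: "t *s b = k *s d" by (auto simp: vec.span_singleton)
      then have "k \<noteq> 0" using t0 b by auto
      have "inverse k *s (t *s b) = d" unfolding k using \<open>k \<noteq> 0\<close> by (simp add: vec.scale_scale)
      then have "d \<in> vec.span {b}" by (metis vec.span_base singletonI vec.span_scale)
      with d0 show False by simp
    qed
    have "t *s b \<in> l" using sl b by (intro vec.subspace_scale)
    then have "l = vec.span {d, t *s b}" by (rule proj_line_eq_span[OF l d(1) _ d00 tb])
    then show ?thesis using that[OF d00 tb _ E0] by blast
  qed
qed

text \<open>A line has q + 1 points altogether, so that many singular points are all of them.
  Together with \<open>anisotropic_line_iff\<close> this translates the values 0 and q + 1 in the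
  duality condition.\<close>

lemma totally_singular_line_iff:
  assumes l: "l \<in> proj_lines"
  shows "(\<forall>x\<in>l. Q x = 0) \<longleftrightarrow> card {P \<in> quadric_points Q. P \<subseteq> l} = CARD('a) + 1"
proof -
  have c: "card {P \<in> proj_points. P \<subseteq> l} = CARD('a) + 1"
    using l card_points_subspace(2)[of l] by (simp add: proj_lines_def)
  have sub: "{P \<in> quadric_points Q. P \<subseteq> l} \<subseteq> {P \<in> proj_points. P \<subseteq> l}"
    by (auto simp: quadric_points_def)
  have "{P \<in> quadric_points Q. P \<subseteq> l} = {P \<in> proj_points. P \<subseteq> l}" if "\<forall>x\<in>l. Q x = 0"
    using that by (auto simp: quadric_points_def)
  moreover have "\<forall>x\<in>l. Q x = 0" if e: "{P \<in> quadric_points Q. P \<subseteq> l} = {P \<in> proj_points. P \<subseteq> l}"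
  proof -
    have "\<forall>P\<in>proj_points. P \<subseteq> l \<longrightarrow> P \<in> quadric_points Q" using e by blast
    then show ?thesis using l quadric_lines_iff[OF Q, of l] by (simp add: quadric_lines_def)
  qed
  ultimately have "(\<forall>x\<in>l. Q x = 0) \<longleftrightarrow> {P \<in> quadric_points Q. P \<subseteq> l} = {P \<in> proj_points. P \<subseteq> l}"
    by (rule iffI)
  also have "\<dots> \<longleftrightarrow> card {P \<in> quadric_points Q. P \<subseteq> l} = card {P \<in> proj_points. P \<subseteq> l}"
    using card_subset_eq[OF _ sub] by (intro iffI arg_cong[of _ _ card]) simp_all
  finally show ?thesis by (simp only: c)
qed

lemma anisotropic_line_iff:
  assumes l: "l \<in> proj_lines"
  shows "(\<forall>x\<in>l. Q x = 0 \<longrightarrow> x = 0) \<longleftrightarrow> card {P \<in> quadric_points Q. P \<subseteq> l} = 0"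
proof -
  have sl: "vec.subspace l" using l by (simp add: proj_lines_def)
  have 1: "vec.span {x} \<in> {P \<in> quadric_points Q. P \<subseteq> l}" if "x \<in> l" "Q x = 0" "x \<noteq> 0" for x
    using that span_singleton_subset_iff[of l x] vec.subspace_scale[OF sl]
    by (simp add: span_singleton_in_quadric_points[OF Q])
  have 2: "\<exists>x\<in>l. Q x = 0 \<and> x \<noteq> 0" if P: "P \<in> quadric_points Q" "P \<subseteq> l" for P
  proof -
    obtain x where "x \<noteq> 0" "P = vec.span {x}" using P by (auto simp: quadric_points_def proj_points_iff)
    moreover then have "x \<in> P" by (simp add: vec.span_base)
    ultimately show ?thesis using P by (auto simp: quadric_points_def)
  qed
  have "(\<forall>x\<in>l. Q x = 0 \<longrightarrow> x = 0) \<longleftrightarrow> {P \<in> quadric_points Q. P \<subseteq> l} = {}"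
  proof
    assume "\<forall>x\<in>l. Q x = 0 \<longrightarrow> x = 0"
    with 2 show "{P \<in> quadric_points Q. P \<subseteq> l} = {}" by blast
  next
    assume e: "{P \<in> quadric_points Q. P \<subseteq> l} = {}"
    show "\<forall>x\<in>l. Q x = 0 \<longrightarrow> x = 0"
    proof (intro ballI impI)
      fix x assume "x \<in> l" "Q x = 0"
      then show "x = 0" using 1[of x] unfolding e by (metis empty_iff)
    qed
  qed
  then show ?thesis by simp
qed

text \<open>The perp has codimension 2, hence odd dimension \<open>Suc d\<close>. Its radical is the
  line itself if that is totally singular and zero if it is anisotropic, thus of even dimension, and
  the rank is odd either way.\<close>

lemma perp_imaginary_line_odd_rank:
  assumes nd: "nondegenerate Q" and n: "CARD('n) = Suc (Suc (Suc d))" "even d"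
    and ind: "a \<noteq> 0" "b \<notin> vec.span {a}" and E0: "E (emb a b) = 0"
  shows "card {P \<in> quadric_points Q. P \<subseteq> perp Q {a, b}} * (CARD('a) - 1) + 1 = CARD('a) ^ d"
proof -
  let ?U1 = "UNIV \<inter> perp Q {a}"
  let ?U = "?U1 \<inter> perp Q {b}"
  have R0: "form_radical Q UNIV = {0}"
    using nd by (auto simp: mem_radical nondegenerate_def polar_form_zero[OF Q] polar_form_commute)
  have s0: "vec.subspace (UNIV :: ('a ^ 'n) set)" by simp
  have d0: "vec.dim (UNIV :: ('a ^ 'n) set) = CARD('n)" by (simp add: card_cart_basis)
  have s1: "vec.subspace ?U1" using subspace_perp[OF Q] by simp
  have s2: "vec.subspace ?U" using s1 subspace_perp[OF Q] by (intro vec.subspace_inter) auto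
  have a: "a \<in> UNIV" "a \<notin> form_radical Q UNIV" using ind R0 by auto
  have d1: "vec.dim ?U1 + 1 = CARD('n)" using dim_inter_perp_nonradical[OF Q s0 a] d0 by simp
  have ab: "a \<in> vec.span {a, b}" "b \<in> vec.span {a, b}" by (simp_all add: vec.span_base)
  have bU: "b \<in> ?U1" using E0 by (simp add: E_emb_eq_zero_iff mem_perp_singleton)
  have "vec.dim ?U + 2 = CARD('n) \<and> even (vec.dim (form_radical Q ?U))"
    using imaginary_line_singular_or_anisotropic[OF E0]
  proof
    assume "\<forall>x\<in>vec.span {a, b}. Q x = 0"
    then have Q0: "Q a = 0" "Q b = 0" using ab by auto
    have R1: "form_radical Q ?U1 = vec.span {a}"
      using radical_inter_perp_singular[OF Q two s0 a Q0(1)] R0 by (simp add: insert_commute)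
    \<comment> \<open>Independence keeps \<open>b\<close> out of the radical, so the second cut
      again loses one dimension and enlarges the radical.\<close>
    then have b: "b \<notin> form_radical Q ?U1" using ind by simp
    have "vec.dim (form_radical Q ?U) = 2"
      using dim_radical_inter_perp_singular[OF Q two s1 bU b Q0(2)] R1 ind by simp
    then show ?thesis using dim_inter_perp_nonradical[OF Q s1 bU b] d1 by simp
  next
    assume "Q a \<noteq> 0 \<and> Q b \<noteq> 0 \<and> polar_form Q a b = 0 \<and> (\<forall>x\<in>vec.span {a, b}. Q x = 0 \<longrightarrow> x = 0)"
    then have ns: "Q a \<noteq> 0" "Q b \<noteq> 0" by auto
    have "form_radical Q ?U1 = {0}"
      using radical_inter_perp_nonsingular[OF Q two s0 a(1) ns(1)] R0 by simp
    then have "form_radical Q ?U = {0}"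
      using radical_inter_perp_nonsingular[OF Q two s1 bU ns(2)] by simp
    then show ?thesis
      using dim_inter_perp_nonradical[OF Q s1 bU nonsingular_not_in_radical[OF Q two ns(2)]] d1 by simp
  qed
  then have "vec.dim ?U = Suc d" "odd (vec.dim ?U + vec.dim (form_radical Q ?U))"
    using n by simp_all
  then have "card {P \<in> quadric_points Q. P \<subseteq> ?U} * (CARD('a) - 1) + 1 = CARD('a) ^ d"
    by (intro card_quadric_points_odd_rank[OF Q two s2])
  moreover have "?U = perp Q {a, b}" by (auto simp: perp_def)
  ultimately show ?thesis by (simp only:)
qed

text \<open>The tangent hyperplane has even dimension \<open>Suc d\<close> and radical spanned by
  \<open>z\<close>, so its rank is odd.\<close>

lemma card_perp_point:
  assumes nd: "nondegenerate Q" and n: "CARD('n) = Suc (Suc d)" "odd d"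
    and z: "z \<noteq> 0" "Q z = 0"
  shows "card {P \<in> quadric_points Q. P \<subseteq> perp Q {z}} * (CARD('a) - 1) + 1 = CARD('a) ^ d"
proof -
  have R0: "form_radical Q UNIV = {0}"
    using nd by (auto simp: mem_radical nondegenerate_def polar_form_zero[OF Q] polar_form_commute)
  have s0: "vec.subspace (UNIV :: ('a ^ 'n) set)" by simp
  have a: "z \<in> UNIV" "z \<notin> form_radical Q UNIV" using z R0 by auto
  have "vec.dim (perp Q {z}) + 1 = CARD('n)"
    using dim_inter_perp_nonradical[OF Q s0 a] by (simp add: card_cart_basis)
  moreover have "vec.dim (form_radical Q (perp Q {z})) = 1"
    using dim_radical_inter_perp_singular[OF Q two s0 a z(2)] R0 by simp
  ultimately show ?thesis
    using n by (intro card_quadric_points_odd_rank[OF Q two subspace_perp[OF Q]]) simp_all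
qed

lemma card_quadric:
  assumes nd: "nondegenerate Q" and n: "CARD('n) = Suc d" "even d"
  shows "card (quadric_points Q) * (CARD('a) - 1) + 1 = CARD('a) ^ d"
proof -
  have R0: "form_radical Q UNIV = {0}"
    using nd by (auto simp: mem_radical nondegenerate_def polar_form_zero[OF Q] polar_form_commute)
  show ?thesis
    using card_quadric_points_odd_rank[OF Q two, of UNIV d] n R0 by (simp add: card_cart_basis)
qed

lemma m_cover_card_lines:
  assumes L: "m_cover Q m L"
  shows "card L * (CARD('a) + 1) = m * card (quadric_points Q)"
proof -
  have "card {p \<in> quadric_points Q. p \<subseteq> l} = CARD('a) + 1" if "l \<in> L" for l
    using that L quadric_lines_iff[OF Q, of l] totally_singular_line_iff[of l]
    by (auto simp: m_cover_def)
  then show ?thesis using m_cover_incidences[OF L subset_refl] by simp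
qed

text \<open>A line of \<open>L\<close> has q + 1 points or one point in the hyperplane, according as
  it lies inside or not. Counting flags thus determines the number of lines inside from the covering
  property.\<close>

lemma m_cover_card_lines_perp_point:
  assumes L: "m_cover Q m L"
  shows "CARD('a) * card {l \<in> L. l \<subseteq> perp Q {z}} + card L =
    m * card {p \<in> quadric_points Q. p \<subseteq> perp Q {z}}"
proof -
  let ?N = "{p \<in> quadric_points Q. p \<subseteq> perp Q {z}}"
  have "card {p \<in> ?N. p \<subseteq> l} = (if l \<subseteq> perp Q {z} then CARD('a) + 1 else 1)" if "l \<in> L" for l
  proof -
    have l: "l \<in> proj_lines" "\<forall>x\<in>l. Q x = 0"
      using that L quadric_lines_iff[OF Q] by (auto simp: m_cover_def)
    then have "{p \<in> ?N. p \<subseteq> l} = {p \<in> proj_points. p \<subseteq> l \<inter> perp Q {z}}"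
      by (auto simp: quadric_points_def)
    then show ?thesis using card_points_line_inter_perp[OF Q l(1)] by simp
  qed
  then have "(\<Sum>l\<in>L. card {p \<in> ?N. p \<subseteq> l}) =
      (\<Sum>l\<in>L. if l \<subseteq> perp Q {z} then CARD('a) + 1 else 1)"
    by (intro sum.cong refl)
  also have "\<dots> = CARD('a) * card {l \<in> L. l \<subseteq> perp Q {z}} + 1 * card L"
    by (rule sum_if_const_nat) simp
  finally show ?thesis using m_cover_incidences[OF L, of ?N] by simp
qed

end

section \<open>Comparison of the counts\<close>

text \<open>The geometric series is multiplied out to the shape of the point counts; for
  \<open>n = -1\<close> both sides are 1.\<close>

lemma theta_geometric:
  assumes "q \<ge> 1"
  shows "theta n q * (q - 1) + 1 = q ^ nat (n + 1)"
proof -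
  obtain p where p: "q = Suc p" using assms by (metis Suc_le_D One_nat_def)
  have "(\<Sum>j<k. q ^ j) * (q - 1) + 1 = q ^ k" for k
    by (induction k) (simp_all add: p algebra_simps)
  then show ?thesis by (simp add: theta_def)
qed

lemma real_of_geometric:
  assumes "N * (q - 1) + 1 = q ^ d" "q \<ge> 2"
  shows "real N = (real q ^ d - 1) / (real q - 1)"
proof -
  have "real (N * (q - 1) + 1) = real q ^ d" using assms(1) by simp
  then have "real N * (real q - 1) + 1 = real q ^ d" using assms(2) by (simp add: of_nat_diff)
  then show ?thesis using assms(2) by (simp add: field_simps)
qed

text \<open>The variables stand for the counts at a point P of the large quadric: \<open>T\<close>
  for the points of the set in the perp of P, and \<open>N\<close> and \<open>A\<close> for the
  singular points and the lines of the cover in the perp over the small field. \<open>Lc\<close> and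
  \<open>NV\<close> are the sizes of the cover and of the small quadric, \<open>t1\<close> and
  \<open>t2\<close> the two theta numbers, \<open>k\<close> is r - 4, and \<open>d\<close> is 1 or 0
  according to membership.\<close>

context
  fixes q m k T N A Lc NV t1 t2 d :: nat
  assumes q: "q \<ge> 2" and NV: "NV * (q - 1) + 1 = q ^ (k + 4)"
    and Lc: "Lc * (q + 1) = m * NV"
    and T: "T + m * N = q\<^sup>2 * A + Lc + N"
    and t2: "t2 * (q\<^sup>2 - 1) + 1 = q ^ (k + 2)"
begin

lemma real_counts:
  "real Lc = real m * (real q ^ 4 * real q ^ k - 1) / ((real q - 1) * (real q + 1))"
  "real t2 = (real q ^ 2 * real q ^ k - 1) / ((real q - 1) * (real q + 1))"
  "real T = real q ^ 2 * real A + real Lc + real N - real m * real N"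
  "real (m * (q\<^sup>2 - q) + q + 1) = real m * (real q ^ 2 - real q) + real q + 1"
proof -
  have "real (Lc * (q + 1)) = real (m * NV)" by (simp only: Lc)
  then have "real Lc = real m * real NV / (real q + 1)" by (simp add: field_simps)
  then show "real Lc = real m * (real q ^ 4 * real q ^ k - 1) / ((real q - 1) * (real q + 1))"
    by (simp add: real_of_geometric[OF NV q] power_add mult.commute)
  have "1 \<le> q\<^sup>2" using q by (simp add: power2_eq_square)
  moreover have "real (t2 * (q\<^sup>2 - 1) + 1) = real q ^ (k + 2)" by (simp only: t2 of_nat_power)
  ultimately have "real t2 * (real q ^ 2 - 1) + 1 = real q ^ (k + 2)"
    by (simp add: of_nat_diff)
  also have "\<dots> = real q ^ 2 * real q ^ k" by (simp only: power_add mult.commute)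
  finally have "real t2 * (real q ^ 2 - 1) + 1 = real q ^ 2 * real q ^ k" .
  moreover have "(real q - 1) * (real q + 1) = real q ^ 2 - 1"
    by (simp add: algebra_simps power2_eq_square)
  moreover have "1 < real q ^ 2" using q by (intro one_less_power) simp_all
  ultimately show "real t2 = (real q ^ 2 * real q ^ k - 1) / ((real q - 1) * (real q + 1))"
    by (simp add: field_simps)
  have "real (T + m * N) = real (q\<^sup>2 * A + Lc + N)" by (simp only: T)
  then show "real T = real q ^ 2 * real A + real Lc + real N - real m * real N" by simp
  have "q \<le> q\<^sup>2" using q by (simp add: power2_eq_square)
  then show "real (m * (q\<^sup>2 - q) + q + 1) = real m * (real q ^ 2 - real q) + real q + 1"
    by (simp add: of_nat_diff)
qed

text \<open>The difference of the two sides of the first equation is q squared times that of the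
  second, after substituting closed forms for all other counts.\<close>

lemma imaginary_point_count_iff:
  assumes N: "N * (q - 1) + 1 = q ^ (k + 2)" and t1: "t1 * (q - 1) + 1 = q ^ k"
  shows "T = (m * (q\<^sup>2 - q) + q + 1) * t2 + d * q ^ (k + 2) \<longleftrightarrow>
    real A = real m * real t1 / (real q + 1) + real d * real q ^ k"
proof -
  \<comment> \<open>The identity holds with q and its \<open>k\<close>-th power as independent
    indeterminates, which leaves plain rational algebra.\<close>
  define x y where "x = real q" and "y = real q ^ k"
  have x: "x - 1 \<noteq> 0" "x + 1 \<noteq> 0" "x \<noteq> 0" using q by (auto simp: x_def)
  have pw: "real q ^ (k + j) = x ^ j * y" for j by (simp only: x_def y_def power_add mult.commute)
  note counts = real_counts(1,2)[folded y_def, folded x_def]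
  have N': "real N = (x ^ 2 * y - 1) / (x - 1)"
    by (simp only: real_of_geometric[OF N q] pw) (simp only: x_def)
  have t1': "real t1 = (y - 1) / (x - 1)"
    by (simp add: real_of_geometric[OF t1 q] x_def y_def)
  have "real T - ((real m * (x ^ 2 - x) + x + 1) * real t2 + real d * (x ^ 2 * y)) =
      x ^ 2 * (real A - (real m * real t1 / (x + 1) + real d * y))"
    unfolding real_counts(3)[folded x_def] counts N' t1'
    using x by (simp add: divide_simps) algebra
  then have "real T = (real m * (x ^ 2 - x) + x + 1) * real t2 + real d * (x ^ 2 * y) \<longleftrightarrow>
      real A = real m * real t1 / (x + 1) + real d * y"
    using x(3) by (metis eq_iff_diff_eq_0 mult_eq_0_iff power_not_zero)
  moreover have "real ((m * (q\<^sup>2 - q) + q + 1) * t2 + d * q ^ (k + 2)) =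
      (real m * (x ^ 2 - x) + x + 1) * real t2 + real d * (x ^ 2 * y)"
    by (simp only: of_nat_add[of "_ * t2"] of_nat_mult of_nat_power pw real_counts(4))
      (simp only: x_def)
  ultimately show ?thesis unfolding x_def y_def by (metis of_nat_eq_iff)
qed

text \<open>Here \<open>A\<close> is no unknown: the additional relation eliminates it, and what
  remains is an identity.\<close>

lemma real_point_count:
  assumes N: "N * (q - 1) + 1 = q ^ (k + 3)" and A: "q * A + Lc = m * N"
  shows "T = (m * (q\<^sup>2 - q) + q + 1) * t2 + q ^ (k + 2)"
proof -
  define x y where "x = real q" and "y = real q ^ k"
  have x: "x - 1 \<noteq> 0" "x + 1 \<noteq> 0" "x \<noteq> 0" using q by (auto simp: x_def)
  have pw: "real q ^ (k + j) = x ^ j * y" for j by (simp only: x_def y_def power_add mult.commute)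
  note counts = real_counts(1,2)[folded y_def, folded x_def]
  have N': "real N = (x ^ 3 * y - 1) / (x - 1)"
    by (simp only: real_of_geometric[OF N q] pw) (simp only: x_def)
  have "real (q * A + Lc) = real (m * N)" by (simp only: A)
  then have A': "x * real A = real m * real N - real Lc" by (simp add: x_def)
  have "real T = x * (x * real A) + real Lc + real N - real m * real N"
    by (simp add: real_counts(3) x_def power2_eq_square)
  also have "\<dots> = (real m * (x ^ 2 - x) + x + 1) * real t2 + x ^ 2 * y"
    unfolding A' N' counts
    using x by (simp add: divide_simps) algebra
  also have "\<dots> = real ((m * (q\<^sup>2 - q) + q + 1) * t2 + q ^ (k + 2))"
    by (simp only: of_nat_add[of "_ * t2"] of_nat_mult of_nat_power pw real_counts(4))
      (simp only: x_def)
  finally show ?thesis by (simp only: of_nat_eq_iff)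
qed

end

section \<open>Membership in the set of extended points\<close>

context quadratic_extension
begin

text \<open>A line of \<open>L\<close> whose extension contains the point contains both
  \<open>a\<close> and \<open>b\<close>, hence is their span.\<close>

lemma ext_points_imaginary_iff:
  assumes L: "m_cover Q m L" and ind: "a \<noteq> 0" "b \<notin> vec.span {a}" and E0: "E (emb a b) = 0"
  shows "vec.span {emb a b} \<in> ext_points h Q L \<longleftrightarrow> vec.span {a, b} \<in> L"
proof -
  have "emb a b \<noteq> 0" using ind by (simp add: emb_eq_zero_iff)
  then have P: "vec.span {emb a b} \<in> quadric_points E"
    using E0 by (simp add: span_singleton_in_quadric_points[OF E])
  have "l = vec.span {a, b}" if "l \<in> L" "a \<in> l" "b \<in> l" for l
    using that ind L proj_line_eq_span[of l a b] by (auto simp: m_cover_def quadric_lines_def)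
  moreover have "vec.subspace l" if "l \<in> L" for l
    using that L by (auto simp: m_cover_def quadric_lines_def proj_lines_def)
  moreover have "a \<in> vec.span {a, b}" "b \<in> vec.span {a, b}" by (simp_all add: vec.span_base)
  ultimately show ?thesis
    using P unfolding ext_points_def
    by (simp add: span_emb_subset_ext_line_iff cong: conj_cong) metis
qed

lemma small_points_in_ext_points:
  assumes L: "m_cover Q m L" and p: "p \<in> quadric_points Q"
  shows "ext_line h p \<in> ext_points h Q L"
proof -
  have "card {l \<in> L. p \<subseteq> l} > 0" using L p by (simp add: m_cover_def)
  then have "{l \<in> L. p \<subseteq> l} \<noteq> {}" by (metis card.empty less_irrefl)
  then obtain l where l: "l \<in> L" "p \<subseteq> l" by blast
  have "vec.subspace l" using l L by (auto simp: m_cover_def quadric_lines_def proj_lines_def)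
  then show ?thesis
    using l p ext_line_in_quadric_points[of p] ext_line_subset_iff[of p l]
    by (auto simp: ext_points_def quadric_points_def proj_points_def)
qed

end

section \<open>Tightness against the duality condition\<close>

theorem theorem4p10:
  fixes Q :: "'a::{field,finite} ^ 'n::finite \<Rightarrow> 'a"
    and h :: "'a \<Rightarrow> 'b::{field,finite}"
    and r q m :: nat
    and L :: "('a ^ 'n) set set"
  assumes "r \<ge> 4" and "even r" and "CARD('n) = r + 1"
    and "CARD('a) = q" and "odd q" and "CARD('b) = q\<^sup>2"
    and "field_embedding h"
    and "quadratic_form Q" and "nondegenerate Q"
    and "m_cover Q m L"
  shows "tight_set r q (ext_form h Q) (m * (q\<^sup>2 - q) + q + 1) (ext_points h Q L)
    \<longleftrightarrow> dual_parabolic_II r q Q m L"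
proof -
  note h = assms(7) and nd = assms(9) and cov = assms(10) and qa = assms(4) and qb = assms(6)
  obtain k where r: "r = k + 4" using assms(1) by (metis le_Suc_ex add.commute)
  have k: "even k" and n: "CARD('n) = k + 5" using assms(2,3) r by simp_all
  have two: "(2::'a) \<noteq> 0" using assms(4,5) by (intro two_neq_zero_of_odd_card) simp
  have q: "q \<ge> 2" using card_field_ge_2[where 'a='a] qa by simp
  obtain om s where om: "om\<^sup>2 = h s" "\<And>x. x\<^sup>2 \<noteq> s" "bij (\<lambda>(x, y). h x + om * h y)"
    using quadratic_extension_basis[OF h two] qa qb by metis
  interpret quadratic_extension h om s Q
    by unfold_locales (fact h om two assms(8))+
  let ?X = "ext_points h Q L" and ?i = "m * (q\<^sup>2 - q) + q + 1"
  let ?t1 = "theta (int r - 5) q" and ?t2 = "theta ((int r - 4) div 2) (q\<^sup>2)"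
  let ?T = "\<lambda>P. card {R \<in> ?X. R \<subseteq> perp E P}"
  let ?A = "\<lambda>l. card {k \<in> L. k \<subseteq> perp Q l}"
  let ?good = "\<lambda>P. ?T P = (if P \<in> ?X then ?i * ?t2 + q ^ (r - 2) else ?i * ?t2)"
  \<comment> \<open>The coefficient \<open>of_bool\<close> merges the two cases of the duality
    condition into one equation.\<close>
  let ?cond = "\<lambda>l. real (?A l) = real m * real ?t1 / (real q + 1) +
    real (of_bool (l \<in> L) :: nat) * real q ^ k"
  \<comment> \<open>The smallest case \<open>r = 4\<close> has index -1, where the theta number is 0
    and \<open>k\<close> is 0.\<close>
  have t1: "?t1 * (q - 1) + 1 = q ^ k"
    using theta_geometric[of q "int r - 5"] q by (simp add: r)
  have "nat ((int r - 4) div 2 + 1) = k div 2 + 1" by (simp add: r nat_add_distrib nat_div_distrib)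
  moreover have "q\<^sup>2 \<ge> 1" using q by (simp add: power2_eq_square)
  ultimately have "?t2 * (q\<^sup>2 - 1) + 1 = q ^ (2 * (k div 2 + 1))"
    using theta_geometric[of "q\<^sup>2" "(int r - 4) div 2"] by (simp only: power_mult)
  also have "2 * (k div 2 + 1) = k + 2" using k by simp
  finally have t2: "?t2 * (q\<^sup>2 - 1) + 1 = q ^ (k + 2)" .
  have NV: "card (quadric_points Q) * (q - 1) + 1 = q ^ (k + 4)"
    using card_quadric[OF nd, of "k + 4"] n k qa by simp
  have Lc: "card L * (q + 1) = m * card (quadric_points Q)"
    using m_cover_card_lines[OF cov] qa by simp
  have count: "?T (vec.span {emb a b}) + m * card {p \<in> quadric_points Q. p \<subseteq> perp Q {a, b}} =
      q\<^sup>2 * ?A {a, b} + card L + card {p \<in> quadric_points Q. p \<subseteq> perp Q {a, b}}" for a b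
    using card_ext_points_incidences[OF cov refl, of a b] by (simp add: perp_span[OF E] qb)
  have imag: "?good (vec.span {emb a b}) \<longleftrightarrow> ?cond (vec.span {a, b})"
    if ind: "a \<noteq> 0" "b \<notin> vec.span {a}" and E0: "E (emb a b) = 0" for a b
  proof -
    have N: "card {p \<in> quadric_points Q. p \<subseteq> perp Q {a, b}} * (q - 1) + 1 = q ^ (k + 2)"
      using perp_imaginary_line_odd_rank[OF nd _ _ ind E0, of "k + 2"] n k qa by simp
    have "?good (vec.span {emb a b}) \<longleftrightarrow>
        ?T (vec.span {emb a b}) = ?i * ?t2 + of_bool (vec.span {a, b} \<in> L) * q ^ (k + 2)"
      using ext_points_imaginary_iff[OF cov that] by (simp add: r)
    also have "\<dots> \<longleftrightarrow> ?cond (vec.span {a, b})"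
      unfolding perp_span[OF Q]
      by (rule imaginary_point_count_iff[OF q NV Lc count t2 N t1])
    finally show ?thesis .
  qed
  have real: "?good (ext_line h p)" if p: "p \<in> proj_points" "ext_line h p \<in> quadric_points E" for p
  proof -
    have pQ: "p \<in> quadric_points Q" using p ext_line_in_quadric_points by blast
    then obtain z where z: "z \<noteq> 0" "p = vec.span {z}" using p by (auto simp: proj_points_iff)
    then have Qz: "Q z = 0" using pQ span_singleton_in_quadric_points[OF Q z(1)] by simp
    \<comment> \<open>A small point has a generator with zero imaginary part, so the general count
      applies with \<open>b = 0\<close>.\<close>
    have e: "ext_line h p = vec.span {emb z 0}"
      using ext_line_in_proj_points[OF p(1)] z
      by (intro proj_point_eq_span) (auto simp: emb_mem_ext_line emb_eq_zero_iff vec.span_base vec.span_zero)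
    have pz: "perp Q {z, 0} = perp Q {z}" by (simp add: perp_def polar_form_zero[OF Q])
    have N: "card {p \<in> quadric_points Q. p \<subseteq> perp Q {z, 0}} * (q - 1) + 1 = q ^ (k + 3)"
      using card_perp_point[OF nd _ _ z(1) Qz, of "k + 3"] n k qa by (simp add: pz)
    have "q * ?A {z, 0} + card L = m * card {p \<in> quadric_points Q. p \<subseteq> perp Q {z, 0}}"
      using m_cover_card_lines_perp_point[OF cov, of z] qa by (simp add: pz)
    from real_point_count[OF q NV Lc count t2 N this] show ?thesis
      using small_points_in_ext_points[OF cov pQ] by (simp add: e r)
  qed
  have tight: "tight_set r q E ?i ?X \<longleftrightarrow> (\<forall>P\<in>quadric_points E. ?good P)"
    by (auto simp: tight_set_def ext_points_def)
  \<comment> \<open>The lines of \<open>L\<close> are totally singular, so the constrained lines are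
    exactly those that arise from imaginary points.\<close>
  have relevant: "(l \<in> L \<or> card {P \<in> quadric_points Q. P \<subseteq> l} \<in> {0, q + 1}) \<longleftrightarrow>
      (\<forall>x\<in>l. Q x = 0) \<or> (\<forall>x\<in>l. Q x = 0 \<longrightarrow> x = 0)" if l: "l \<in> proj_lines" for l
    using totally_singular_line_iff[OF l] anisotropic_line_iff[OF l] cov qa
      quadric_lines_iff[OF Q, of l] by (auto simp: m_cover_def)
  have dual: "dual_parabolic_II r q Q m L \<longleftrightarrow>
      (\<forall>l\<in>proj_lines. (\<forall>x\<in>l. Q x = 0) \<or> (\<forall>x\<in>l. Q x = 0 \<longrightarrow> x = 0) \<longrightarrow> ?cond l)"
    unfolding dual_parabolic_II_def
    by (intro ball_cong refl, subst relevant[symmetric]) (auto simp: r)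
  show ?thesis
    unfolding tight dual
  proof (intro iffI ballI impI)
    fix l assume good: "\<forall>P\<in>quadric_points E. ?good P" and l: "l \<in> proj_lines"
      and Ql: "(\<forall>x\<in>l. Q x = 0) \<or> (\<forall>x\<in>l. Q x = 0 \<longrightarrow> x = 0)"
    obtain a b where ab: "a \<noteq> 0" "b \<notin> vec.span {a}" "l = vec.span {a, b}" "E (emb a b) = 0"
      by (rule line_obtain_imaginary[OF l Ql])
    then have "vec.span {emb a b} \<in> quadric_points E"
      by (simp add: span_singleton_in_quadric_points[OF E] emb_eq_zero_iff)
    with good have "?good (vec.span {emb a b})" by (rule bspec)
    then show "?cond l" unfolding ab(3) imag[OF ab(1,2,4)] .
  next
    fix P assume c: "\<forall>l\<in>proj_lines. (\<forall>x\<in>l. Q x = 0) \<or> (\<forall>x\<in>l. Q x = 0 \<longrightarrow> x = 0) \<longrightarrow> ?cond l"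
      and P: "P \<in> quadric_points E"
    then obtain w where w: "w \<noteq> 0" "P = vec.span {w}" by (auto simp: quadric_points_def proj_points_iff)
    obtain a b where wab: "w = emb a b" by (rule obtain_emb)
    have E0: "E (emb a b) = 0" using P w wab span_singleton_in_quadric_points[OF E w(1)] by simp
    show "?good P"
    \<comment> \<open>Independent parts mean an imaginary point, governed by the condition on its
      line; otherwise the point is small and its equation holds automatically.\<close>
    proof (cases "a \<noteq> 0 \<and> b \<notin> vec.span {a}")
      case True
      then have ind: "a \<noteq> 0" "b \<notin> vec.span {a}" by auto
      have "?cond (vec.span {a, b})"
      proof (rule c[THEN bspec, THEN mp])
        show "vec.span {a, b} \<in> proj_lines" by (rule proj_lines_span[OF ind])
      qed (use imaginary_line_singular_or_anisotropic[OF E0] in blast)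
      then show ?thesis unfolding w(2) wab imag[OF ind E0] .
    next
      case False
      have "a \<noteq> 0 \<or> b \<noteq> 0" using w wab by (auto simp: emb_zero)
      then obtain p where p: "p \<in> proj_points" "vec.span {emb a b} = ext_line h p"
        by (rule emb_dependent[OF False])
      then have "P = ext_line h p" using w wab by simp
      with P show ?thesis using real[OF p(1)] by (simp only:)
    qed
  qed
qed

end
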